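(* Let $G$ and $H$ be finite groups and $F:\mathrm{Fin}^G\to\mathrm{Fin}^H$ a functor. The following are equivalent: (1) $F$ preserves pullbacks, epimorphisms, and finite coproducts (disjoint unions); (2) $F$ is of the form $F=-\times_G X$ (up to natural isomorphism) for some $X\in{}_{G}\mathrm{Fin}^H$.
   Context: $\mathrm{Fin}^G$ is the category of finite free right $G$-sets and $G$-equivariant maps. ${}_{G}\mathrm{Fin}^H$ is the category of finite sets with commuting left $G$-action and right $H$-action such that the right $H$-action is free (no condition on the left $G$-action). For a right $G$-set $S$ and a left $G$-set $X$, $S\times_G X=(S\times X)/\sim$, where $\sim$ is the equivalence relation defined by $(sg,x)\sim(s,gx)$ for $g\in G$; if $X$ has a commuting right $H$-action then $S\times_G X$ is a right $H$-set. *)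

theory Defs
  imports "HOL-Algebra.Group_Action"
begin

section \<open>Categories and functors\<close>

text \<open>Categories are given by hom-sets. Hom-sets need not be disjoint (an arrow does not determine its
  source and target), so composition and the arrow part of a functor take the objects involved as
  arguments: \<open>cmp C a b c g f\<close> is \<open>g \<circ> f\<close> for \<open>f : a \<rightarrow> b\<close> and \<open>g : b \<rightarrow> c\<close>, and \<open>fmap F a b f\<close> is
  \<open>F f : F a \<rightarrow> F b\<close> for \<open>f : a \<rightarrow> b\<close>.\<close>

record ('o, 'm) cat =
  Ob :: "'o set"
  Arr :: "'o \<Rightarrow> 'o \<Rightarrow> 'm set"
  ident :: "'o \<Rightarrow> 'm"
  cmp :: "'o \<Rightarrow> 'o \<Rightarrow> 'o \<Rightarrow> 'm \<Rightarrow> 'm \<Rightarrow> 'm"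

definition is_category :: "('o, 'm) cat \<Rightarrow> bool" where
  "is_category C \<longleftrightarrow>
     (\<forall>a\<in>Ob C. ident C a \<in> Arr C a a) \<and>
     (\<forall>a\<in>Ob C. \<forall>b\<in>Ob C. \<forall>c\<in>Ob C. \<forall>f\<in>Arr C a b. \<forall>g\<in>Arr C b c. cmp C a b c g f \<in> Arr C a c) \<and>
     (\<forall>a\<in>Ob C. \<forall>b\<in>Ob C. \<forall>f\<in>Arr C a b.
        cmp C a a b f (ident C a) = f \<and> cmp C a b b (ident C b) f = f) \<and>
     (\<forall>a\<in>Ob C. \<forall>b\<in>Ob C. \<forall>c\<in>Ob C. \<forall>d\<in>Ob C.
        \<forall>f\<in>Arr C a b. \<forall>g\<in>Arr C b c. \<forall>h\<in>Arr C c d.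
        cmp C a b d (cmp C b c d h g) f = cmp C a c d h (cmp C a b c g f))"

record ('o1, 'm1, 'o2, 'm2) funct =
  fobj :: "'o1 \<Rightarrow> 'o2"
  fmap :: "'o1 \<Rightarrow> 'o1 \<Rightarrow> 'm1 \<Rightarrow> 'm2"

definition is_functor ::
    "('o1, 'm1) cat \<Rightarrow> ('o2, 'm2) cat \<Rightarrow> ('o1, 'm1, 'o2, 'm2) funct \<Rightarrow> bool" where
  "is_functor C D F \<longleftrightarrow>
     (\<forall>a\<in>Ob C. fobj F a \<in> Ob D) \<and>
     (\<forall>a\<in>Ob C. \<forall>b\<in>Ob C. \<forall>f\<in>Arr C a b. fmap F a b f \<in> Arr D (fobj F a) (fobj F b)) \<and>
     (\<forall>a\<in>Ob C. fmap F a a (ident C a) = ident D (fobj F a)) \<and>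
     (\<forall>a\<in>Ob C. \<forall>b\<in>Ob C. \<forall>c\<in>Ob C. \<forall>f\<in>Arr C a b. \<forall>g\<in>Arr C b c.
        fmap F a c (cmp C a b c g f)
          = cmp D (fobj F a) (fobj F b) (fobj F c) (fmap F b c g) (fmap F a b f))"

definition is_epi :: "('o, 'm) cat \<Rightarrow> 'o \<Rightarrow> 'o \<Rightarrow> 'm \<Rightarrow> bool" where
  "is_epi C a b f \<longleftrightarrow> a \<in> Ob C \<and> b \<in> Ob C \<and> f \<in> Arr C a b \<and>
     (\<forall>c\<in>Ob C. \<forall>g\<in>Arr C b c. \<forall>h\<in>Arr C b c. cmp C a b c g f = cmp C a b c h f \<longrightarrow> g = h)"

text \<open>\<open>is_pullback C p a b c p1 p2 f g\<close>: the square with \<open>p1 : p \<rightarrow> a\<close>, \<open>p2 : p \<rightarrow> b\<close>,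
  \<open>f : a \<rightarrow> c\<close>, \<open>g : b \<rightarrow> c\<close> commutes and is cartesian.\<close>

definition is_pullback ::
    "('o, 'm) cat \<Rightarrow> 'o \<Rightarrow> 'o \<Rightarrow> 'o \<Rightarrow> 'o \<Rightarrow> 'm \<Rightarrow> 'm \<Rightarrow> 'm \<Rightarrow> 'm \<Rightarrow> bool" where
  "is_pullback C p a b c p1 p2 f g \<longleftrightarrow>
     p \<in> Ob C \<and> a \<in> Ob C \<and> b \<in> Ob C \<and> c \<in> Ob C \<and>
     p1 \<in> Arr C p a \<and> p2 \<in> Arr C p b \<and> f \<in> Arr C a c \<and> g \<in> Arr C b c \<and>
     cmp C p a c f p1 = cmp C p b c g p2 \<and>
     (\<forall>q\<in>Ob C. \<forall>u\<in>Arr C q a. \<forall>v\<in>Arr C q b. cmp C q a c f u = cmp C q b c g v \<longrightarrow>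
        (\<exists>!w. w \<in> Arr C q p \<and> cmp C q p a p1 w = u \<and> cmp C q p b p2 w = v))"

text \<open>\<open>is_coproduct C n A s i\<close>: the object \<open>s\<close> with the injections \<open>i k : A k \<rightarrow> s\<close> is a coproduct of
  the finite family \<open>A 0, \<dots>, A (n - 1)\<close>; for \<open>n = 0\<close> this says that \<open>s\<close> is initial.\<close>

definition is_coproduct ::
    "('o, 'm) cat \<Rightarrow> nat \<Rightarrow> (nat \<Rightarrow> 'o) \<Rightarrow> 'o \<Rightarrow> (nat \<Rightarrow> 'm) \<Rightarrow> bool" where
  "is_coproduct C n A s i \<longleftrightarrow>
     s \<in> Ob C \<and> (\<forall>k<n. A k \<in> Ob C \<and> i k \<in> Arr C (A k) s) \<and>
     (\<forall>t\<in>Ob C. \<forall>j. (\<forall>k<n. j k \<in> Arr C (A k) t) \<longrightarrow>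
        (\<exists>!w. w \<in> Arr C s t \<and> (\<forall>k<n. cmp C (A k) s t w (i k) = j k)))"

definition preserves_epis ::
    "('o1, 'm1) cat \<Rightarrow> ('o2, 'm2) cat \<Rightarrow> ('o1, 'm1, 'o2, 'm2) funct \<Rightarrow> bool" where
  "preserves_epis C D F \<longleftrightarrow>
     (\<forall>a b f. is_epi C a b f \<longrightarrow> is_epi D (fobj F a) (fobj F b) (fmap F a b f))"

definition preserves_pullbacks ::
    "('o1, 'm1) cat \<Rightarrow> ('o2, 'm2) cat \<Rightarrow> ('o1, 'm1, 'o2, 'm2) funct \<Rightarrow> bool" where
  "preserves_pullbacks C D F \<longleftrightarrow>
     (\<forall>p a b c p1 p2 f g. is_pullback C p a b c p1 p2 f g \<longrightarrow>
        is_pullback D (fobj F p) (fobj F a) (fobj F b) (fobj F c)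
          (fmap F p a p1) (fmap F p b p2) (fmap F a c f) (fmap F b c g))"

definition preserves_finite_coproducts ::
    "('o1, 'm1) cat \<Rightarrow> ('o2, 'm2) cat \<Rightarrow> ('o1, 'm1, 'o2, 'm2) funct \<Rightarrow> bool" where
  "preserves_finite_coproducts C D F \<longleftrightarrow>
     (\<forall>n A s i. is_coproduct C n A s i \<longrightarrow>
        is_coproduct D n (\<lambda>k. fobj F (A k)) (fobj F s) (\<lambda>k. fmap F (A k) s (i k)))"

section \<open>Finite free right \<open>G\<close>-sets\<close>

text \<open>The library's \<open>group_action\<close> is a left action; right actions are spelled out.\<close>

record ('g, 'a) rset =
  pts :: "'a set"
  ract :: "'a \<Rightarrow> 'g \<Rightarrow> 'a"

definition right_action :: "('g, 'm) monoid_scheme \<Rightarrow> ('g, 'a, 'z) rset_scheme \<Rightarrow> bool" where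
  "right_action G S \<longleftrightarrow>
     (\<forall>s\<in>pts S. \<forall>g\<in>carrier G. ract S s g \<in> pts S) \<and>
     (\<forall>s\<in>pts S. ract S s \<one>\<^bsub>G\<^esub> = s) \<and>
     (\<forall>s\<in>pts S. \<forall>g\<in>carrier G. \<forall>h\<in>carrier G. ract S s (g \<otimes>\<^bsub>G\<^esub> h) = ract S (ract S s g) h)"

definition free_action :: "('g, 'm) monoid_scheme \<Rightarrow> ('g, 'a, 'z) rset_scheme \<Rightarrow> bool" where
  "free_action G S \<longleftrightarrow> (\<forall>s\<in>pts S. \<forall>g\<in>carrier G. ract S s g = s \<longrightarrow> g = \<one>\<^bsub>G\<^esub>)"

text \<open>Off \<open>pts S \<times> carrier G\<close> the action takes the value \<open>undefined\<close>, and equivariant maps are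
  extensional on \<open>pts S\<close>, so that equality of objects and arrows is the intended one.\<close>

definition fin_free_rset :: "('g, 'm) monoid_scheme \<Rightarrow> ('g, 'a, 'z) rset_scheme \<Rightarrow> bool" where
  "fin_free_rset G S \<longleftrightarrow> finite (pts S) \<and> right_action G S \<and> free_action G S \<and>
     (\<forall>s g. \<not> (s \<in> pts S \<and> g \<in> carrier G) \<longrightarrow> ract S s g = undefined)"

definition equivariant_maps ::
    "('g, 'm) monoid_scheme \<Rightarrow> ('g, 'a) rset \<Rightarrow> ('g, 'b) rset \<Rightarrow> ('a \<Rightarrow> 'b) set" where
  "equivariant_maps G S T =
     {f \<in> pts S \<rightarrow>\<^sub>E pts T. \<forall>s\<in>pts S. \<forall>g\<in>carrier G. f (ract S s g) = ract T (f s) g}"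

text \<open>The category of those finite free right \<open>G\<close>-sets whose points lie in the type \<open>'a\<close>; it is
  equivalent to the category of all finite free right \<open>G\<close>-sets whenever \<open>'a\<close> is infinite.\<close>

definition FinCat :: "('g, 'm) monoid_scheme \<Rightarrow> (('g, 'a) rset, 'a \<Rightarrow> 'a) cat" where
  "FinCat G =
     \<lparr>Ob = {S. fin_free_rset G S},
      Arr = equivariant_maps G,
      ident = (\<lambda>S. \<lambda>s\<in>pts S. s),
      cmp = (\<lambda>S T U g f. compose (pts S) g f)\<rparr>"

definition equivariant_iso ::
    "('g, 'm) monoid_scheme \<Rightarrow> ('g, 'a) rset \<Rightarrow> ('g, 'b) rset \<Rightarrow> ('a \<Rightarrow> 'b) \<Rightarrow> bool" where
  "equivariant_iso G S T f \<longleftrightarrow> f \<in> equivariant_maps G S T \<and>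
     (\<exists>k\<in>equivariant_maps G T S. (\<forall>s\<in>pts S. k (f s) = s) \<and> (\<forall>t\<in>pts T. f (k t) = t))"

text \<open>Natural isomorphism of functors \<open>E, E'\<close> from \<open>FinCat G\<close> to finite free right \<open>H\<close>-sets. The values
  of \<open>E\<close> and \<open>E'\<close> may have their points in different types.\<close>

definition naturally_isomorphic ::
    "('g, 'm) monoid_scheme \<Rightarrow> ('h, 'n) monoid_scheme \<Rightarrow>
     (('g, 'a) rset, 'a \<Rightarrow> 'a, ('h, 'b) rset, 'b \<Rightarrow> 'b) funct \<Rightarrow>
     (('g, 'a) rset, 'a \<Rightarrow> 'a, ('h, 'c) rset, 'c \<Rightarrow> 'c) funct \<Rightarrow> bool" where
  "naturally_isomorphic G H E E' \<longleftrightarrow>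
     (\<exists>\<eta>. (\<forall>S\<in>Ob (FinCat G). equivariant_iso H (fobj E S) (fobj E' S) (\<eta> S)) \<and>
          (\<forall>S\<in>Ob (FinCat G). \<forall>T\<in>Ob (FinCat G). \<forall>f\<in>Arr (FinCat G) S T.
             \<forall>y\<in>pts (fobj E S). \<eta> T (fmap E S T f y) = fmap E' S T f (\<eta> S y)))"

section \<open>Bisets and the functor \<open>- \<times>\<^sub>G X\<close>\<close>

record ('g, 'h, 'x) biset = "('h, 'x) rset" +
  lact :: "'g \<Rightarrow> 'x \<Rightarrow> 'x"

definition fin_biset ::
    "('g, 'm) monoid_scheme \<Rightarrow> ('h, 'n) monoid_scheme \<Rightarrow> ('g, 'h, 'x) biset \<Rightarrow> bool" where
  "fin_biset G H X \<longleftrightarrow> fin_free_rset H X \<and> group_action G (pts X) (lact X) \<and>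
     (\<forall>g\<in>carrier G. \<forall>x\<in>pts X. \<forall>h\<in>carrier H. lact X g (ract X x h) = ract X (lact X g x) h)"

text \<open>Because \<open>G\<close> is a group, the generating relation \<open>(s g, x) \<sim> (s, g x)\<close> is already an equivalence
  relation; see \<open>equiv_tensor_rel\<close> below.\<close>

definition tensor_rel ::
    "('g, 'm) monoid_scheme \<Rightarrow> ('g, 'a) rset \<Rightarrow> ('g, 'h, 'x) biset \<Rightarrow> (('a \<times> 'x) \<times> ('a \<times> 'x)) set" where
  "tensor_rel G S X =
     {((ract S s g, x), (s, lact X g x)) | s g x. s \<in> pts S \<and> g \<in> carrier G \<and> x \<in> pts X}"

text \<open>The action of \<open>h\<close> on a class is \<open>[s, x] h = [s, x h]\<close>.\<close>

definition tensor ::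
    "('g, 'm) monoid_scheme \<Rightarrow> ('h, 'n) monoid_scheme \<Rightarrow> ('g, 'a) rset \<Rightarrow> ('g, 'h, 'x) biset \<Rightarrow>
     ('h, ('a \<times> 'x) set) rset" where
  "tensor G H S X =
     \<lparr>pts = (pts S \<times> pts X) // tensor_rel G S X,
      ract = (\<lambda>c h. if c \<in> (pts S \<times> pts X) // tensor_rel G S X \<and> h \<in> carrier H
                    then tensor_rel G S X `` ((\<lambda>(s, x). (s, ract X x h)) ` c)
                    else undefined)\<rparr>"

text \<open>On arrows, \<open>f : S \<rightarrow> T\<close> is sent to \<open>[s, x] \<mapsto> [f s, x]\<close>.\<close>

definition tensor_functor ::
    "('g, 'm) monoid_scheme \<Rightarrow> ('h, 'n) monoid_scheme \<Rightarrow> ('g, 'h, 'x) biset \<Rightarrow>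
     (('g, 'a) rset, 'a \<Rightarrow> 'a, ('h, ('a \<times> 'x) set) rset, ('a \<times> 'x) set \<Rightarrow> ('a \<times> 'x) set) funct" where
  "tensor_functor G H X =
     \<lparr>fobj = (\<lambda>S. tensor G H S X),
      fmap = (\<lambda>S T f. \<lambda>c\<in>pts (tensor G H S X). tensor_rel G T X `` ((\<lambda>(s, x). (f s, x)) ` c))\<rparr>"

section \<open>Well-definedness\<close>

lemma FinCat_is_category: "is_category (FinCat G)"
  unfolding is_category_def FinCat_def
  by (auto simp: equivariant_maps_def compose_def restrict_def PiE_def Pi_def extensional_def
      fin_free_rset_def right_action_def fun_eq_iff)

lemma lact_facts:
  assumes "group G" "fin_biset G H X"
  shows "g \<in> carrier G \<Longrightarrow> x \<in> pts X \<Longrightarrow> lact X g x \<in> pts X"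
    and "x \<in> pts X \<Longrightarrow> lact X \<one>\<^bsub>G\<^esub> x = x"
    and "g \<in> carrier G \<Longrightarrow> k \<in> carrier G \<Longrightarrow> x \<in> pts X \<Longrightarrow>
           lact X (g \<otimes>\<^bsub>G\<^esub> k) x = lact X g (lact X k x)"
proof -
  interpret group_action G "pts X" "lact X" using assms by (simp add: fin_biset_def)
  show "g \<in> carrier G \<Longrightarrow> x \<in> pts X \<Longrightarrow> lact X g x \<in> pts X"
    by (rule element_image) auto
  show "x \<in> pts X \<Longrightarrow> lact X \<one>\<^bsub>G\<^esub> x = x"
    using id_eq_one by (metis restrict_apply')
  show "g \<in> carrier G \<Longrightarrow> k \<in> carrier G \<Longrightarrow> x \<in> pts X \<Longrightarrow>
           lact X (g \<otimes>\<^bsub>G\<^esub> k) x = lact X g (lact X k x)"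
    by (rule composition_rule)
qed

lemma tensor_rel_iff:
  "(p, q) \<in> tensor_rel G S X \<longleftrightarrow> fst q \<in> pts S \<and> snd p \<in> pts X \<and>
     (\<exists>g\<in>carrier G. fst p = ract S (fst q) g \<and> snd q = lact X g (snd p))"
  unfolding tensor_rel_def by (cases p; cases q) auto

lemma equiv_tensor_rel:
  assumes G: "group G" and S: "right_action G S" and X: "fin_biset G H X"
  shows "equiv (pts S \<times> pts X) (tensor_rel G S X)"
proof (rule equivI)
  interpret group G by (rule G)
  note L = lact_facts[OF G X]
  have R: "\<And>s g. s \<in> pts S \<Longrightarrow> g \<in> carrier G \<Longrightarrow> ract S s g \<in> pts S"
    "\<And>s. s \<in> pts S \<Longrightarrow> ract S s \<one>\<^bsub>G\<^esub> = s"
    "\<And>s g h. s \<in> pts S \<Longrightarrow> g \<in> carrier G \<Longrightarrow> h \<in> carrier G \<Longrightarrow>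
       ract S s (g \<otimes>\<^bsub>G\<^esub> h) = ract S (ract S s g) h"
    using S by (auto simp: right_action_def)
  show "tensor_rel G S X \<subseteq> (pts S \<times> pts X) \<times> (pts S \<times> pts X)"
    using L R unfolding tensor_rel_def by auto
  show "refl_on (pts S \<times> pts X) (tensor_rel G S X)"
    unfolding refl_on_def by (auto simp: tensor_rel_iff L R intro!: bexI[of _ "\<one>\<^bsub>G\<^esub>"])
  show "sym (tensor_rel G S X)"
  proof (rule symI)
    fix p q assume "(p, q) \<in> tensor_rel G S X"
    then obtain g where g: "fst q \<in> pts S" "snd p \<in> pts X" "g \<in> carrier G"
      "fst p = ract S (fst q) g" "snd q = lact X g (snd p)"
      by (auto simp: tensor_rel_iff)
    have "fst q = ract S (fst p) (inv\<^bsub>G\<^esub> g)" "snd p = lact X (inv\<^bsub>G\<^esub> g) (snd q)"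
      using g by (simp_all add: R(2) L(2) flip: R(3) L(3))
    then show "(q, p) \<in> tensor_rel G S X"
      using g L R by (auto simp: tensor_rel_iff intro!: bexI[of _ "inv\<^bsub>G\<^esub> g"])
  qed
  show "trans (tensor_rel G S X)"
  proof (rule transI)
    fix p q r assume "(p, q) \<in> tensor_rel G S X" "(q, r) \<in> tensor_rel G S X"
    then obtain g k where "fst r \<in> pts S" "snd p \<in> pts X" "g \<in> carrier G" "k \<in> carrier G"
      "fst p = ract S (ract S (fst r) k) g" "snd r = lact X k (lact X g (snd p))"
      by (auto simp: tensor_rel_iff)
    then show "(p, r) \<in> tensor_rel G S X"
      using L R by (auto simp: tensor_rel_iff intro!: bexI[of _ "k \<otimes>\<^bsub>G\<^esub> g"])
  qed
qed

lemma class_image: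
  assumes "equiv A r" "equiv B r'" "a \<in> A"
    and "\<And>p q. (p, q) \<in> r \<Longrightarrow> (\<phi> p, \<phi> q) \<in> r'"
  shows "r' `` (\<phi> ` (r `` {a})) = r' `` {\<phi> a}"
proof -
  have "(a, a) \<in> r" using assms by (meson equiv_class_self Image_singleton_iff)
  moreover have "r' `` {\<phi> q} = r' `` {\<phi> a}" if "(a, q) \<in> r" for q
    using equiv_class_eq[OF assms(2) assms(4)[OF that]] by simp
  ultimately show ?thesis by blast
qed

lemma tensor_facts:
  assumes G: "group G" and S: "right_action G S" and X: "fin_biset G H X"
  shows "pts (tensor G H S X) = {tensor_rel G S X `` {(s, x)} | s x. s \<in> pts S \<and> x \<in> pts X}"
    and "s \<in> pts S \<Longrightarrow> x \<in> pts X \<Longrightarrow> h \<in> carrier H \<Longrightarrow>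
      ract (tensor G H S X) (tensor_rel G S X `` {(s, x)}) h = tensor_rel G S X `` {(s, ract X x h)}"
    and "s \<in> pts S \<Longrightarrow> x \<in> pts X \<Longrightarrow> s' \<in> pts S \<Longrightarrow> x' \<in> pts X \<Longrightarrow>
      tensor_rel G S X `` {(s, x)} = tensor_rel G S X `` {(s', x')} \<longleftrightarrow>
        (\<exists>g\<in>carrier G. s = ract S s' g \<and> x' = lact X g x)"
proof -
  note E = equiv_tensor_rel[OF G S X]
  show "pts (tensor G H S X) = {tensor_rel G S X `` {(s, x)} | s x. s \<in> pts S \<and> x \<in> pts X}"
    by (auto simp: tensor_def quotient_def)
  show "ract (tensor G H S X) (tensor_rel G S X `` {(s, x)}) h = tensor_rel G S X `` {(s, ract X x h)}"
    if "s \<in> pts S" "x \<in> pts X" "h \<in> carrier H"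
  proof -
    have "tensor_rel G S X `` ((\<lambda>(s, x). (s, ract X x h)) ` (tensor_rel G S X `` {(s, x)}))
        = tensor_rel G S X `` {(\<lambda>(s, x). (s, ract X x h)) (s, x)}"
      using X that
      by (intro class_image[OF E E]) (auto simp: tensor_rel_iff fin_biset_def fin_free_rset_def
          right_action_def)
    moreover have "tensor_rel G S X `` {(s, x)} \<in> (pts S \<times> pts X) // tensor_rel G S X"
      using that by (auto intro: quotientI)
    ultimately show ?thesis using that by (simp add: tensor_def)
  qed
  show "tensor_rel G S X `` {(s, x)} = tensor_rel G S X `` {(s', x')} \<longleftrightarrow>
        (\<exists>g\<in>carrier G. s = ract S s' g \<and> x' = lact X g x)"
    if "s \<in> pts S" "x \<in> pts X" "s' \<in> pts S" "x' \<in> pts X"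
    using that by (subst eq_equiv_class_iff[OF E]) (auto simp: tensor_rel_iff)
qed

lemma tensor_fin_free:
  assumes G: "group G" and H: "group H" and S: "fin_free_rset G S" and X: "fin_biset G H X"
  shows "fin_free_rset H (tensor G H S X)"
proof -
  interpret H: group H by (rule H)
  have S': "right_action G S" using S by (simp add: fin_free_rset_def)
  have XH: "right_action H X" "free_action H X" "finite (pts X)"
    using X by (auto simp: fin_biset_def fin_free_rset_def)
  note T = tensor_facts[OF G S' X] and L = lact_facts[OF G X]
  have fin: "finite (pts (tensor G H S X))"
    using S XH finite_quotient[of "pts S \<times> pts X" "tensor_rel G S X"]
      equiv_tensor_rel[OF G S' X] by (simp add: tensor_def fin_free_rset_def equiv_def)
  have ra: "right_action H (tensor G H S X)"
    unfolding right_action_def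
    using T(2) XH(1) by (auto simp: T(1) right_action_def; blast)
  have fr: "free_action H (tensor G H S X)"
    unfolding free_action_def
  proof (intro ballI impI)
    fix c h assume "c \<in> pts (tensor G H S X)" and h: "h \<in> carrier H"
      and eq: "ract (tensor G H S X) c h = c"
    then obtain s x where sx: "s \<in> pts S" "x \<in> pts X" "c = tensor_rel G S X `` {(s, x)}"
      using T(1) by auto
    have xh: "ract X x h \<in> pts X" using sx h XH(1) by (simp add: right_action_def)
    have "tensor_rel G S X `` {(s, x)} = tensor_rel G S X `` {(s, ract X x h)}"
      using eq sx h T(2) by simp
    then obtain g where g: "g \<in> carrier G" "s = ract S s g" "ract X x h = lact X g x"
      using T(3)[OF sx(1,2) sx(1) xh] by auto
    then have "g = \<one>\<^bsub>G\<^esub>" using S sx by (simp add: fin_free_rset_def free_action_def)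
    then have "ract X x h = x" using g L sx by simp
    then show "h = \<one>\<^bsub>H\<^esub>" using XH(2) h sx by (simp add: free_action_def)
  qed
  show ?thesis
    using fin ra fr by (auto simp: fin_free_rset_def tensor_def)
qed

lemma tensor_functor_map:
  assumes G: "group G" and S: "fin_free_rset G S" and T: "fin_free_rset G T"
    and X: "fin_biset G H X" and f: "f \<in> equivariant_maps G S T"
    and s: "s \<in> pts S" and x: "x \<in> pts X"
  shows "fmap (tensor_functor G H X) S T f (tensor_rel G S X `` {(s, x)})
    = tensor_rel G T X `` {(f s, x)}"
proof -
  have S': "right_action G S" and T': "right_action G T"
    using S T by (simp_all add: fin_free_rset_def)
  have "tensor_rel G T X `` ((\<lambda>(s, x). (f s, x)) ` (tensor_rel G S X `` {(s, x)}))
      = tensor_rel G T X `` {(\<lambda>(s, x). (f s, x)) (s, x)}"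
    using f s x
    by (intro class_image[OF equiv_tensor_rel[OF G S' X] equiv_tensor_rel[OF G T' X]])
      (auto simp: tensor_rel_iff equivariant_maps_def)
  then show ?thesis
    using s x by (auto simp: tensor_functor_def tensor_facts(1)[OF G S' X])
qed

lemma tensor_functor_is_functor:
  fixes X :: "('g, 'h, 'x) biset"
  assumes G: "group G" and H: "group H" and X: "fin_biset G H X"
  shows "is_functor (FinCat G :: (('g, 'a) rset, 'a \<Rightarrow> 'a) cat) (FinCat H) (tensor_functor G H X)"
proof -
  note M = tensor_functor_map[OF G _ _ X] and F = tensor_fin_free[OF G H _ X]
  have tf: "right_action G S" if "fin_free_rset G S" for S :: "('g, 'a) rset"
    using that by (simp add: fin_free_rset_def)
  note T = tensor_facts[OF G tf X]
  have XH: "right_action H X" using X by (auto simp: fin_biset_def fin_free_rset_def)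
  have ext: "fmap (tensor_functor G H X) S T f \<in> extensional (pts (tensor G H S X))"
    for S T :: "('g, 'a) rset" and f
    by (simp add: tensor_functor_def)
  have ob: "fobj (tensor_functor G H X) S = tensor G H S X" for S :: "('g, 'a) rset"
    by (simp add: tensor_functor_def)
  have id: "(\<lambda>s\<in>pts S. s) \<in> equivariant_maps G S S" if "fin_free_rset G S" for S :: "('g, 'a) rset"
    using tf[OF that] by (auto simp: equivariant_maps_def right_action_def)
  have co: "compose (pts S) g f \<in> equivariant_maps G S U"
    if "fin_free_rset G S" "f \<in> equivariant_maps G S T" "g \<in> equivariant_maps G T U"
    for S T U :: "('g, 'a) rset" and f g
    using tf[OF that(1)] that(2,3)
    by (auto simp: equivariant_maps_def right_action_def compose_def PiE_def Pi_def)
  have arr: "fmap (tensor_functor G H X) S T f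
      \<in> equivariant_maps H (tensor G H S X) (tensor G H T X)"
    if S: "fin_free_rset G S" and T': "fin_free_rset G T" and f: "f \<in> equivariant_maps G S T"
    for S T :: "('g, 'a) rset" and f
  proof -
    have "f s \<in> pts T" if "s \<in> pts S" for s using f that by (auto simp: equivariant_maps_def)
    then show ?thesis
      using ext[of S T f] XH
      by (auto simp: equivariant_maps_def PiE_def T(1)[OF S] T(1)[OF T'] T(2)[OF S] T(2)[OF T']
          M[OF S T' f] right_action_def; blast)
  qed
  show ?thesis
    unfolding is_functor_def FinCat_def cat.simps ob mem_Collect_eq
  proof (intro conjI allI impI ballI)
    fix S :: "('g, 'a) rset" assume S: "S \<in> {S. fin_free_rset G S}"
    then have S: "fin_free_rset G S" by simp
    show "fin_free_rset H (tensor G H S X)" by (rule F[OF S])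
    show "fmap (tensor_functor G H X) S S (\<lambda>s\<in>pts S. s) = (\<lambda>s\<in>pts (tensor G H S X). s)"
      by (rule extensionalityI[OF ext]) (auto simp: T(1)[OF S] M[OF S S id[OF S]])
    fix T' :: "('g, 'a) rset" and f assume "T' \<in> {S. fin_free_rset G S}"
      and f: "f \<in> equivariant_maps G S T'"
    then have T': "fin_free_rset G T'" by simp
    show "fmap (tensor_functor G H X) S T' f
      \<in> equivariant_maps H (tensor G H S X) (tensor G H T' X)"
      by (rule arr[OF S T' f])
    fix U :: "('g, 'a) rset" and g assume "U \<in> {S. fin_free_rset G S}"
      and g: "g \<in> equivariant_maps G T' U"
    then have U: "fin_free_rset G U" by simp
    have "f s \<in> pts T'" if "s \<in> pts S" for s using f that by (auto simp: equivariant_maps_def)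
    then show "fmap (tensor_functor G H X) S U (compose (pts S) g f)
      = compose (pts (tensor G H S X)) (fmap (tensor_functor G H X) T' U g)
          (fmap (tensor_functor G H X) S T' f)"
      by (intro extensionalityI[OF ext compose_extensional])
        (auto simp: T(1)[OF S] M[OF S T' f] M[OF T' U g] M[OF S U co[OF S f g]] compose_eq)
  qed
qed

end

theory Submission
  imports Defs
begin

text \<open>
  A functor \<open>F\<close> that is isomorphic to \<open>- \<times>\<^sub>G X\<close> comes with maps \<open>S \<times> X \<rightarrow> F S\<close>, written \<open>[s, x]\<close> here,
  that are surjective, natural in \<open>S\<close>, equivariant for \<open>H\<close>, and identify exactly \<open>[s g, x]\<close> with
  \<open>[s, g x]\<close>; and conversely such maps are a natural isomorphism. The locale \<open>tensor_presentation\<close>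
  records them, and both implications are proved by computing with \<open>[s, x]\<close>.

  For the preservation properties, the categorical notions are first expressed by points:
  epimorphisms are the surjections (\<open>is_epi_FinCat_iff\<close>), pullbacks are fibre products of sets
  (\<open>is_pullback_FinCat_iff\<close>), and coproducts are disjoint unions (\<open>is_coproduct_FinCat_iff\<close>). That
  surjections and disjoint unions are preserved is then immediate from \<open>F f [s, x] = [f s, x]\<close>. For a
  pullback of \<open>f : A \<rightarrow> C\<close> and \<open>g : B \<rightarrow> C\<close>, a point of the fibre product of \<open>F A\<close> and \<open>F B\<close> can be
  normalised to \<open>([a, x], [b, x])\<close> with \<open>f a = g b\<close>, and it comes from a unique point because \<open>G\<close>
  acts freely on \<open>C\<close>.

  In the other direction, let \<open>R\<close> be \<open>G\<close> as a right \<open>G\<close>-set. Its endomorphisms are the left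
  multiplications, so that \<open>X = F R\<close> carries a left \<open>G\<close>-action that commutes with \<open>H\<close>. A point \<open>s\<close> of
  \<open>S\<close> is the same as a map \<open>R \<rightarrow> S\<close>, and applying \<open>F\<close> to it gives a map \<open>X \<rightarrow> F S\<close>; this is \<open>[s, -]\<close>.
  A finite free \<open>G\<close>-set is a disjoint union of copies of \<open>R\<close> (\<open>coproduct_of_orbits\<close>), a coproduct that
  \<open>F\<close> preserves, and hence \<open>F S\<close> is the disjoint union of copies of \<open>X\<close> indexed by the orbits of \<open>S\<close>,
  as \<open>S \<times>\<^sub>G X\<close> is.
\<close>

section \<open>Arrows and objects\<close>

lemma FinCat_simps [simp]:
  "Ob (FinCat G) = {S. fin_free_rset G S}"
  "Arr (FinCat G) = equivariant_maps G"
  "ident (FinCat G) S = (\<lambda>s\<in>pts S. s)"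
  "cmp (FinCat G) S T U g f = compose (pts S) g f"
  by (simp_all add: FinCat_def)

lemma equivariant_maps_iff:
  "f \<in> equivariant_maps G S T \<longleftrightarrow> f \<in> extensional (pts S) \<and> (\<forall>s\<in>pts S. f s \<in> pts T) \<and>
     (\<forall>s\<in>pts S. \<forall>g\<in>carrier G. f (ract S s g) = ract T (f s) g)"
  by (auto simp: equivariant_maps_def PiE_def Pi_def)

lemma equivariant_maps_eqI:
  assumes "f \<in> equivariant_maps G S T" "f' \<in> equivariant_maps G S T"
    and "\<And>s. s \<in> pts S \<Longrightarrow> f s = f' s"
  shows "f = f'"
  using assms by (meson equivariant_maps_iff extensionalityI)

lemma fin_free_rsetD:
  assumes "fin_free_rset G S"
  shows "finite (pts S)"
    and "right_action G S"
    and "free_action G S"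
    and "s \<in> pts S \<Longrightarrow> g \<in> carrier G \<Longrightarrow> ract S s g \<in> pts S"
    and "s \<in> pts S \<Longrightarrow> ract S s \<one>\<^bsub>G\<^esub> = s"
    and "s \<in> pts S \<Longrightarrow> g \<in> carrier G \<Longrightarrow> h \<in> carrier G \<Longrightarrow>
      ract S s (g \<otimes>\<^bsub>G\<^esub> h) = ract S (ract S s g) h"
  using assms by (auto simp: fin_free_rset_def right_action_def)

lemma equivariant_maps_compose:
  assumes "fin_free_rset G S" "f \<in> equivariant_maps G S T" "g \<in> equivariant_maps G T U"
  shows "compose (pts S) g f \<in> equivariant_maps G S U"
  using assms by (auto simp: equivariant_maps_iff compose_eq fin_free_rsetD)

lemma free_action_cancel:
  assumes G: "group G" and S: "fin_free_rset G S" and s: "s \<in> pts S"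
    and g: "g \<in> carrier G" and h: "h \<in> carrier G" and eq: "ract S s g = ract S s h"
  shows "g = h"
proof -
  interpret group G by (rule G)
  note D = fin_free_rsetD[OF S]
  have "ract S s (g \<otimes>\<^bsub>G\<^esub> inv\<^bsub>G\<^esub> h) = ract S s (h \<otimes>\<^bsub>G\<^esub> inv\<^bsub>G\<^esub> h)"
    using s g h eq by (simp only: D(6) inv_closed)
  then have "ract S s (g \<otimes>\<^bsub>G\<^esub> inv\<^bsub>G\<^esub> h) = s" using s h by (simp add: D)
  then have "g \<otimes>\<^bsub>G\<^esub> inv\<^bsub>G\<^esub> h = \<one>\<^bsub>G\<^esub>" using D(3) s g h by (simp add: free_action_def)
  then show ?thesis using g h by (metis inv_closed inv_equality inv_inv)
qed

lemma equivariant_iso_iff_bij_betw: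
  assumes S: "right_action G S"
  shows "equivariant_iso G S T f \<longleftrightarrow> f \<in> equivariant_maps G S T \<and> bij_betw f (pts S) (pts T)"
proof (intro iffI conjI; (elim conjE)?)
  assume "equivariant_iso G S T f"
  then obtain k where f: "f \<in> equivariant_maps G S T" and k: "k \<in> equivariant_maps G T S"
    and kf: "\<forall>s\<in>pts S. k (f s) = s" and fk: "\<forall>t\<in>pts T. f (k t) = t"
    by (auto simp: equivariant_iso_def)
  show "f \<in> equivariant_maps G S T" by (rule f)
  show "bij_betw f (pts S) (pts T)"
    using f k kf fk by (intro bij_betw_byWitness[of _ k]) (auto simp: equivariant_maps_iff)
next
  assume f: "f \<in> equivariant_maps G S T" and b: "bij_betw f (pts S) (pts T)"
  define k where "k = (\<lambda>t\<in>pts T. inv_into (pts S) f t)"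
  have kf: "\<forall>s\<in>pts S. k (f s) = s"
    using f b by (auto simp: k_def equivariant_maps_iff bij_betw_def)
  have kT: "\<forall>t\<in>pts T. k t \<in> pts S \<and> f (k t) = t"
    using b by (auto simp: k_def bij_betw_def f_inv_into_f inv_into_into)
  have "k (ract T t g) = ract S (k t) g" if "t \<in> pts T" "g \<in> carrier G" for t g
  proof -
    have "ract S (k t) g \<in> pts S" using S kT that by (simp add: right_action_def)
    moreover have "f (ract S (k t) g) = ract T t g"
      using f kT that by (simp add: equivariant_maps_iff)
    ultimately show ?thesis using kf by metis
  qed
  then have "k \<in> equivariant_maps G T S"
    using kT by (auto simp: equivariant_maps_iff k_def)
  then show "equivariant_iso G S T f"
    using f kf kT by (auto simp: equivariant_iso_def)
qed

text \<open>An infinite type has room for every finite free \<open>G\<close>-set, so that the auxiliary objects below can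
  be written down on whatever type is convenient and then moved into the category at hand.\<close>

lemma fin_free_rset_copy:
  fixes S :: "('g, 'c, 'z) rset_scheme"
  assumes inf: "infinite (UNIV :: 'a set)" and G: "group G" and fin: "finite (pts S)"
    and ra: "right_action G S" and fr: "free_action G S"
  obtains T :: "('g, 'a) rset" and e where "fin_free_rset G T" "bij_betw e (pts S) (pts T)"
    "\<And>s g. s \<in> pts S \<Longrightarrow> g \<in> carrier G \<Longrightarrow> ract T (e s) g = e (ract S s g)"
proof -
  obtain B :: "'a set" where B: "finite B" "card B = card (pts S)"
    using infinite_arbitrarily_large[OF inf] by blast
  obtain e where e: "bij_betw e (pts S) B"
    using finite_same_card_bij[OF fin B(1)] B(2) by auto
  define d where "d = inv_into (pts S) e"
  have d: "\<And>s. s \<in> pts S \<Longrightarrow> d (e s) = s" "\<And>b. b \<in> B \<Longrightarrow> d b \<in> pts S" "\<And>b. b \<in> B \<Longrightarrow> e (d b) = b"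
    "\<And>s. s \<in> pts S \<Longrightarrow> e s \<in> B"
    using e by (auto simp: d_def bij_betw_def f_inv_into_f inv_into_into)
  define T :: "('g, 'a) rset" where
    "T = \<lparr>pts = B, ract = (\<lambda>t g. if t \<in> B \<and> g \<in> carrier G then e (ract S (d t) g) else undefined)\<rparr>"
  have T: "pts T = B" "\<And>b g. b \<in> B \<Longrightarrow> g \<in> carrier G \<Longrightarrow> ract T b g = e (ract S (d b) g)"
    "\<And>b g. \<not> (b \<in> B \<and> g \<in> carrier G) \<Longrightarrow> ract T b g = undefined"
    by (auto simp: T_def)
  have "right_action G T"
  proof -
    interpret group G by (rule G)
    show ?thesis using ra d by (auto simp: right_action_def T)
  qed
  moreover have "free_action G T"
    unfolding free_action_def
  proof (intro ballI impI)
    fix b g assume b: "b \<in> pts T" and g: "g \<in> carrier G" and eq: "ract T b g = b"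
    have "ract S (d b) g = d (e (ract S (d b) g))" using b g d ra by (simp add: right_action_def T)
    also have "\<dots> = d b" using b g eq by (simp add: T)
    finally have "ract S (d b) g = d b" .
    moreover have "d b \<in> pts S" using b d by (simp add: T)
    ultimately show "g = \<one>\<^bsub>G\<^esub>" using fr g by (simp add: free_action_def)
  qed
  ultimately have "fin_free_rset G T" using B(1) T by (simp add: fin_free_rset_def)
  moreover have "bij_betw e (pts S) (pts T)" using e by (simp add: T_def)
  moreover have "ract T (e s) g = e (ract S s g)" if "s \<in> pts S" "g \<in> carrier G" for s g
    using that d by (simp add: T_def)
  ultimately show ?thesis by (rule that)
qed

section \<open>The regular \<open>G\<close>-set\<close>

text \<open>The group acting on itself, with its points renamed by \<open>e\<close>. It represents the functor of points
  (\<open>equivariant_map_eq_orbit_map\<close>), so that a test against it turns a universal property into a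
  statement about elements.\<close>

locale regular_rset =
  fixes G :: "('g, 'm) monoid_scheme" and R :: "('g, 'a) rset" and e :: "'g \<Rightarrow> 'a"
  assumes G: "group G" and R: "fin_free_rset G R"
    and bij_e: "bij_betw e (carrier G) (pts R)"
    and ract_e: "\<And>g k. g \<in> carrier G \<Longrightarrow> k \<in> carrier G \<Longrightarrow> ract R (e g) k = e (g \<otimes>\<^bsub>G\<^esub> k)"
begin

sublocale group G by (rule G)

definition orbit_map :: "('g, 'b) rset \<Rightarrow> 'b \<Rightarrow> 'a \<Rightarrow> 'b" where
  "orbit_map S s = (\<lambda>r\<in>pts R. ract S s (inv_into (carrier G) e r))"

lemma e_in [simp]: "g \<in> carrier G \<Longrightarrow> e g \<in> pts R"
  using bij_e by (auto simp: bij_betw_def)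

lemma pts_R: "pts R = e ` carrier G"
  using bij_e by (auto simp: bij_betw_def)

lemma orbit_map_e [simp]: "g \<in> carrier G \<Longrightarrow> orbit_map S s (e g) = ract S s g"
  using bij_e by (simp add: orbit_map_def bij_betw_def)

lemma orbit_map_arr:
  assumes "fin_free_rset G S" "s \<in> pts S"
  shows "orbit_map S s \<in> equivariant_maps G R S"
  using assms
  by (auto simp: equivariant_maps_iff pts_R ract_e fin_free_rsetD) (simp add: orbit_map_def pts_R)

lemma equivariant_map_eq_orbit_map:
  assumes S: "fin_free_rset G S" and u: "u \<in> equivariant_maps G R S"
  shows "u = orbit_map S (u (e \<one>\<^bsub>G\<^esub>))"
proof (rule equivariant_maps_eqI[OF u orbit_map_arr[OF S]])
  show "u (e \<one>\<^bsub>G\<^esub>) \<in> pts S" using u by (simp add: equivariant_maps_iff)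
  fix r assume "r \<in> pts R"
  then obtain g where g: "g \<in> carrier G" "r = e g" by (auto simp: pts_R)
  then have "u r = u (ract R (e \<one>\<^bsub>G\<^esub>) g)" by (simp add: ract_e)
  then show "u r = orbit_map S (u (e \<one>\<^bsub>G\<^esub>)) r" using u g by (simp add: equivariant_maps_iff)
qed

lemma compose_orbit_map:
  assumes S: "fin_free_rset G S" and T: "fin_free_rset G T" and f: "f \<in> equivariant_maps G S T"
    and s: "s \<in> pts S"
  shows "compose (pts R) f (orbit_map S s) = orbit_map T (f s)"
  using equivariant_map_eq_orbit_map[OF T equivariant_maps_compose[OF R orbit_map_arr[OF S s] f]] s
  by (simp add: compose_eq fin_free_rsetD[OF S])

end

lemma regular_rset_exists:
  fixes G :: "('g, 'm) monoid_scheme"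
  assumes inf: "infinite (UNIV :: 'a set)" and G: "group G" and fin: "finite (carrier G)"
  obtains R :: "('g, 'a) rset" and e where "regular_rset G R e"
proof -
  interpret group G by (rule G)
  let ?S = "\<lparr>pts = carrier G, ract = (\<lambda>s g. s \<otimes>\<^bsub>G\<^esub> g)\<rparr>"
  have "finite (pts ?S)" "right_action G ?S" "free_action G ?S"
    using fin by (auto simp: right_action_def free_action_def m_assoc)
  from fin_free_rset_copy[OF inf G this] show ?thesis
    using that G unfolding regular_rset_def by (metis rset.select_convs)
qed

section \<open>Epimorphisms, pullbacks and coproducts in terms of points\<close>

text \<open>Two maps into \<open>T \<times> bool\<close> that agree exactly on a given invariant subset: one stays in a single
  copy of \<open>T\<close>, the other changes to the second copy off \<open>I\<close>. The latter is equivariant because the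
  complement of an invariant subset is invariant as well. This is what makes a (jointly) epimorphic
  family (jointly) surjective.\<close>

lemma separating_maps:
  fixes T :: "('g, 'a) rset"
  assumes inf: "infinite (UNIV :: 'a set)" and G: "group G" and T: "fin_free_rset G T"
    and I: "I \<subseteq> pts T" "\<And>t g. t \<in> I \<Longrightarrow> g \<in> carrier G \<Longrightarrow> ract T t g \<in> I"
  obtains U :: "('g, 'a) rset" and u v where "fin_free_rset G U"
    "u \<in> equivariant_maps G T U" "v \<in> equivariant_maps G T U"
    "\<And>t. t \<in> pts T \<Longrightarrow> u t = v t \<longleftrightarrow> t \<in> I"
proof -
  interpret group G by (rule G)
  note D = fin_free_rsetD[OF T]
  let ?D = "\<lparr>pts = pts T \<times> (UNIV :: bool set), ract = (\<lambda>p g. (ract T (fst p) g, snd p))\<rparr>"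
  have "finite (pts ?D)" "right_action G ?D" "free_action G ?D"
    using D by (auto simp: right_action_def free_action_def)
  then obtain U :: "('g, 'a) rset" and e where U: "fin_free_rset G U"
    and e: "bij_betw e (pts T \<times> (UNIV :: bool set)) (pts U)"
    and re: "\<And>t b g. t \<in> pts T \<Longrightarrow> g \<in> carrier G \<Longrightarrow> ract U (e (t, b)) g = e (ract T t g, b)"
    by (rule fin_free_rset_copy[OF inf G]) auto
  have eU: "e (t, b) \<in> pts U" if "t \<in> pts T" for t b
    using that e by (auto simp: bij_betw_def)
  have I_iff: "ract T t g \<in> I \<longleftrightarrow> t \<in> I" if "t \<in> pts T" "g \<in> carrier G" for t g
  proof
    assume "ract T t g \<in> I"
    then have "ract T (ract T t g) (inv\<^bsub>G\<^esub> g) \<in> I" using that I(2) by simp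
    then show "t \<in> I" using that D by (simp flip: D(6))
  qed (use that I in auto)
  let ?u = "\<lambda>t\<in>pts T. e (t, True)" and ?v = "\<lambda>t\<in>pts T. e (t, t \<in> I)"
  have "?u \<in> equivariant_maps G T U" "?v \<in> equivariant_maps G T U"
    using I_iff by (auto simp: equivariant_maps_iff eU re D(4))
  moreover have "?u t = ?v t \<longleftrightarrow> t \<in> I" if "t \<in> pts T" for t
    using that e inj_onD[of e _ "(t, True)" "(t, t \<in> I)"] by (auto simp: bij_betw_def)
  ultimately show ?thesis using U that by blast
qed

lemma is_epi_FinCat_iff:
  fixes S T :: "('g, 'a) rset"
  assumes inf: "infinite (UNIV :: 'a set)" and G: "group G"
  shows "is_epi (FinCat G) S T f \<longleftrightarrow>
    fin_free_rset G S \<and> fin_free_rset G T \<and> f \<in> equivariant_maps G S T \<and> f ` pts S = pts T"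
proof (intro iffI; (elim conjE)?)
  assume epi: "is_epi (FinCat G) S T f"
  then have S: "fin_free_rset G S" and T: "fin_free_rset G T" and f: "f \<in> equivariant_maps G S T"
    by (auto simp: is_epi_def)
  have I: "f ` pts S \<subseteq> pts T" "\<And>t g. t \<in> f ` pts S \<Longrightarrow> g \<in> carrier G \<Longrightarrow> ract T t g \<in> f ` pts S"
    using f fin_free_rsetD(4)[OF S] by (auto simp: equivariant_maps_iff) (metis imageI)
  obtain U :: "('g, 'a) rset" and u v where U: "fin_free_rset G U"
    and u: "u \<in> equivariant_maps G T U" and v: "v \<in> equivariant_maps G T U"
    and uv: "\<And>t. t \<in> pts T \<Longrightarrow> u t = v t \<longleftrightarrow> t \<in> f ` pts S"
    using separating_maps[OF inf G T I] by blast
  have "u (f s) = v (f s)" if "s \<in> pts S" for s using uv I(1) that by blast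
  then have "compose (pts S) u f = compose (pts S) v f"
    by (auto simp: compose_def restrict_def)
  then have "u = v" using epi U u v by (simp add: is_epi_def)
  then show "fin_free_rset G S \<and> fin_free_rset G T \<and> f \<in> equivariant_maps G S T \<and>
    f ` pts S = pts T"
    using S T f I(1) uv by blast
next
  assume S: "fin_free_rset G S" and T: "fin_free_rset G T" and f: "f \<in> equivariant_maps G S T"
    and onto: "f ` pts S = pts T"
  have "u = v" if "u \<in> equivariant_maps G T U" "v \<in> equivariant_maps G T U"
    "compose (pts S) u f = compose (pts S) v f" for U :: "('g, 'a) rset" and u v
  proof (rule equivariant_maps_eqI[OF that(1,2)])
    fix t assume "t \<in> pts T"
    then obtain s where "s \<in> pts S" "t = f s" using onto by auto
    then show "u t = v t" using fun_cong[OF that(3), of s] by (simp add: compose_eq)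
  qed
  then show "is_epi (FinCat G) S T f" using S T f by (auto simp: is_epi_def)
qed

text \<open>A point of \<open>P\<close> is a map from the regular \<open>G\<close>-set to \<open>P\<close>, so testing the universal property on it
  yields the bijection. Conversely, the bijection gives mediating maps point by point, and these are
  equivariant because points of \<open>P\<close> are determined by their two projections.\<close>

lemma is_pullback_FinCat_iff:
  fixes P A B C :: "('g, 'a) rset"
  assumes inf: "infinite (UNIV :: 'a set)" and G: "group G" and fin: "finite (carrier G)"
  shows "is_pullback (FinCat G) P A B C p q f g \<longleftrightarrow>
    fin_free_rset G P \<and> fin_free_rset G A \<and> fin_free_rset G B \<and> fin_free_rset G C \<and>
    p \<in> equivariant_maps G P A \<and> q \<in> equivariant_maps G P B \<and>
    f \<in> equivariant_maps G A C \<and> g \<in> equivariant_maps G B C \<and>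
    bij_betw (\<lambda>x. (p x, q x)) (pts P) {(a, b). a \<in> pts A \<and> b \<in> pts B \<and> f a = g b}"
    (is "?pb \<longleftrightarrow> ?rhs")
proof
  assume pb: ?pb
  then have P: "fin_free_rset G P" and A: "fin_free_rset G A" and B: "fin_free_rset G B"
    and C: "fin_free_rset G C"
    and p: "p \<in> equivariant_maps G P A" and q: "q \<in> equivariant_maps G P B"
    and f: "f \<in> equivariant_maps G A C" and g: "g \<in> equivariant_maps G B C"
    and comm: "compose (pts P) f p = compose (pts P) g q"
    by (simp_all add: is_pullback_def)
  have univ: "\<exists>!w. w \<in> equivariant_maps G Q P \<and> compose (pts Q) p w = u \<and> compose (pts Q) q w = v"
    if "fin_free_rset G Q" "u \<in> equivariant_maps G Q A" "v \<in> equivariant_maps G Q B"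
      "compose (pts Q) f u = compose (pts Q) g v" for Q :: "('g, 'a) rset" and u v
    using pb that by (simp add: is_pullback_def)
  obtain R :: "('g, 'a) rset" and e where "regular_rset G R e"
    by (rule regular_rset_exists[OF inf G fin])
  then interpret regular_rset G R e .
  have mem: "p x \<in> pts A" "q x \<in> pts B" "f (p x) = g (q x)" if "x \<in> pts P" for x
    using that p q fun_cong[OF comm, of x] by (simp_all add: equivariant_maps_iff compose_eq)
  have "x = y" if x: "x \<in> pts P" and y: "y \<in> pts P" and eq: "p x = p y" "q x = q y" for x y
  proof -
    have "compose (pts R) f (orbit_map A (p x)) = compose (pts R) g (orbit_map B (q x))"
      using mem x by (simp add: compose_orbit_map[OF A C f] compose_orbit_map[OF B C g])
    from univ[OF R orbit_map_arr orbit_map_arr this] have "orbit_map P x = orbit_map P y"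
      using x y eq mem A B orbit_map_arr[OF P] compose_orbit_map[OF P A p]
        compose_orbit_map[OF P B q] by metis
    then have "orbit_map P x (e \<one>\<^bsub>G\<^esub>) = orbit_map P y (e \<one>\<^bsub>G\<^esub>)" by simp
    then show ?thesis using x y by (simp add: fin_free_rsetD[OF P])
  qed
  moreover have "\<exists>x\<in>pts P. p x = a \<and> q x = b" if a: "a \<in> pts A" and b: "b \<in> pts B"
    and eq: "f a = g b" for a b
  proof -
    have "compose (pts R) f (orbit_map A a) = compose (pts R) g (orbit_map B b)"
      using a b eq by (simp add: compose_orbit_map[OF A C f] compose_orbit_map[OF B C g])
    from univ[OF R orbit_map_arr[OF A a] orbit_map_arr[OF B b] this]
    obtain w where w: "w \<in> equivariant_maps G R P"
      and "compose (pts R) p w = orbit_map A a" "compose (pts R) q w = orbit_map B b" by blast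
    then have "compose (pts R) p w (e \<one>\<^bsub>G\<^esub>) = a" "compose (pts R) q w (e \<one>\<^bsub>G\<^esub>) = b"
      using a b by (simp_all add: fin_free_rsetD[OF A] fin_free_rsetD[OF B])
    then show ?thesis
      using w by (intro bexI[of _ "w (e \<one>\<^bsub>G\<^esub>)"]) (simp_all add: compose_eq equivariant_maps_iff)
  qed
  ultimately have "bij_betw (\<lambda>x. (p x, q x)) (pts P) {(a, b). a \<in> pts A \<and> b \<in> pts B \<and> f a = g b}"
    using mem by (fastforce simp: bij_betw_def inj_on_def image_iff)
  then show ?rhs using P A B C p q f g by blast
next
  assume ?rhs
  then have P: "fin_free_rset G P" and A: "fin_free_rset G A" and B: "fin_free_rset G B"
    and C: "fin_free_rset G C"
    and p: "p \<in> equivariant_maps G P A" and q: "q \<in> equivariant_maps G P B"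
    and f: "f \<in> equivariant_maps G A C" and g: "g \<in> equivariant_maps G B C"
    and bij: "bij_betw (\<lambda>x. (p x, q x)) (pts P) {(a, b). a \<in> pts A \<and> b \<in> pts B \<and> f a = g b}"
    by auto
  have inj: "x = y" if "x \<in> pts P" "y \<in> pts P" "p x = p y" "q x = q y" for x y
    using bij that by (auto simp: bij_betw_def inj_on_def)
  have surj: "\<exists>x\<in>pts P. p x = a \<and> q x = b" if "a \<in> pts A" "b \<in> pts B" "f a = g b" for a b
  proof -
    have "(a, b) \<in> (\<lambda>x. (p x, q x)) ` pts P" using bij that by (simp add: bij_betw_def)
    then show ?thesis by auto
  qed
  have mem: "p x \<in> pts A" "q x \<in> pts B" "f (p x) = g (q x)" if "x \<in> pts P" for x
  proof -
    have "(p x, q x) \<in> {(a, b). a \<in> pts A \<and> b \<in> pts B \<and> f a = g b}"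
      using bij that by (auto simp: bij_betw_def)
    then show "p x \<in> pts A" "q x \<in> pts B" "f (p x) = g (q x)" by auto
  qed
  have "\<exists>!w. w \<in> equivariant_maps G Q P \<and> compose (pts Q) p w = u \<and> compose (pts Q) q w = v"
    if Q: "fin_free_rset G Q" and u: "u \<in> equivariant_maps G Q A" and v: "v \<in> equivariant_maps G Q B"
      and uv: "compose (pts Q) f u = compose (pts Q) g v" for Q :: "('g, 'a) rset" and u v
  proof (rule ex_ex1I)
    have "\<exists>y. y \<in> pts P \<and> p y = u x \<and> q y = v x" if "x \<in> pts Q" for x
      using surj[of "u x" "v x"] that u v fun_cong[OF uv, of x]
      by (auto simp: equivariant_maps_iff compose_eq)
    then obtain w0 where w0: "\<And>x. x \<in> pts Q \<Longrightarrow> w0 x \<in> pts P \<and> p (w0 x) = u x \<and> q (w0 x) = v x"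
      by metis
    define w where "w = restrict w0 (pts Q)"
    have w: "w x \<in> pts P" "p (w x) = u x" "q (w x) = v x" if "x \<in> pts Q" for x
      using w0 that by (simp_all add: w_def)
    have "w (ract Q x h) = ract P (w x) h" if x: "x \<in> pts Q" and h: "h \<in> carrier G" for x h
    proof (rule inj)
      show "w (ract Q x h) \<in> pts P" "ract P (w x) h \<in> pts P"
        using w x h fin_free_rsetD(4)[OF Q] fin_free_rsetD(4)[OF P] by auto
      show "p (w (ract Q x h)) = p (ract P (w x) h)" "q (w (ract Q x h)) = q (ract P (w x) h)"
        using w x h fin_free_rsetD(4)[OF Q] p q u v by (auto simp: equivariant_maps_iff)
    qed
    then have "w \<in> equivariant_maps G Q P" using w by (auto simp: equivariant_maps_iff w_def)
    moreover have "compose (pts Q) p w = u" "compose (pts Q) q w = v"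
      using w u v by (auto simp: equivariant_maps_iff compose_eq intro!: extensionalityI[of _ "pts Q"])
    ultimately show "\<exists>w. w \<in> equivariant_maps G Q P \<and> compose (pts Q) p w = u \<and>
      compose (pts Q) q w = v" by blast
  next
    fix w w'
    assume w: "w \<in> equivariant_maps G Q P \<and> compose (pts Q) p w = u \<and> compose (pts Q) q w = v"
      and w': "w' \<in> equivariant_maps G Q P \<and> compose (pts Q) p w' = u \<and> compose (pts Q) q w' = v"
    show "w = w'"
    proof (rule equivariant_maps_eqI)
      show "w \<in> equivariant_maps G Q P" "w' \<in> equivariant_maps G Q P" using w w' by auto
      fix x assume x: "x \<in> pts Q"
      have "p (w x) = p (w' x)" "q (w x) = q (w' x)" using w w' x by (metis compose_eq)+
      moreover have "w x \<in> pts P" "w' x \<in> pts P" using w w' x unfolding equivariant_maps_iff by blast+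
      ultimately show "w x = w' x" using inj[of "w x" "w' x"] by simp
    qed
  qed
  moreover have "compose (pts P) f p = compose (pts P) g q"
    using mem by (auto simp: compose_def restrict_def)
  ultimately show ?pb
    using P A B C p q f g unfolding is_pullback_def by simp
qed

text \<open>The mediating map into the disjoint union of the \<open>A k\<close> forces the injections to be jointly
  injective; \<open>separating_maps\<close>, applied to the union of their images, forces them to be jointly
  surjective.\<close>

lemma is_coproduct_FinCat_iff:
  fixes A :: "nat \<Rightarrow> ('g, 'a) rset" and S :: "('g, 'a) rset"
  assumes inf: "infinite (UNIV :: 'a set)" and G: "group G"
  shows "is_coproduct (FinCat G) n A S i \<longleftrightarrow>
    fin_free_rset G S \<and> (\<forall>k<n. fin_free_rset G (A k) \<and> i k \<in> equivariant_maps G (A k) S) \<and>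
    bij_betw (\<lambda>(k, a). i k a) (SIGMA k:{..<n}. pts (A k)) (pts S)"
    (is "?co \<longleftrightarrow> ?rhs")
proof
  assume co: ?co
  then have S: "fin_free_rset G S" and A: "\<And>k. k < n \<Longrightarrow> fin_free_rset G (A k)"
    and i: "\<And>k. k < n \<Longrightarrow> i k \<in> equivariant_maps G (A k) S"
    by (auto simp: is_coproduct_def)
  have univ: "\<exists>!w. w \<in> equivariant_maps G S T \<and> (\<forall>k<n. compose (pts (A k)) w (i k) = j k)"
    if "fin_free_rset G T" "\<And>k. k < n \<Longrightarrow> j k \<in> equivariant_maps G (A k) T"
    for T :: "('g, 'a) rset" and j
    using co that by (simp add: is_coproduct_def)
  note DA = fin_free_rsetD[OF A]
  let ?D = "\<lparr>pts = (SIGMA k:{..<n}. pts (A k)), ract = (\<lambda>p g. (fst p, ract (A (fst p)) (snd p) g))\<rparr>"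
  have "finite (pts ?D)" "right_action G ?D" "free_action G ?D"
    using DA by (auto simp: right_action_def free_action_def)
  then obtain U :: "('g, 'a) rset" and e where U: "fin_free_rset G U"
    and e: "bij_betw e (SIGMA k:{..<n}. pts (A k)) (pts U)"
    and re: "\<And>k a g. k < n \<Longrightarrow> a \<in> pts (A k) \<Longrightarrow> g \<in> carrier G \<Longrightarrow>
      ract U (e (k, a)) g = e (k, ract (A k) a g)"
    by (rule fin_free_rset_copy[OF inf G]) auto
  have eU: "e (k, a) \<in> pts U" if "k < n" "a \<in> pts (A k)" for k a
    using that e by (auto simp: bij_betw_def)
  define j where "j k = (\<lambda>a\<in>pts (A k). e (k, a))" for k
  have "j k \<in> equivariant_maps G (A k) U" if "k < n" for k
    using that DA by (auto simp: equivariant_maps_iff j_def eU re)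
  from univ[OF U this] obtain w where w: "\<And>k. k < n \<Longrightarrow> compose (pts (A k)) w (i k) = j k" by blast
  have we: "w (i k a) = e (k, a)" if "k < n" "a \<in> pts (A k)" for k a
    using fun_cong[OF w[OF that(1)], of a] that by (simp add: j_def compose_eq)
  have inj: "inj_on (\<lambda>(k, a). i k a) (SIGMA k:{..<n}. pts (A k))"
  proof (rule inj_on_imageI2[of w], rule inj_on_cong[THEN iffD2])
    show "inj_on e (SIGMA k:{..<n}. pts (A k))" using e by (simp add: bij_betw_def)
  qed (auto simp: we)
  define I where "I = (\<lambda>(k, a). i k a) ` (SIGMA k:{..<n}. pts (A k))"
  have iI: "i k a \<in> I" if "k < n" "a \<in> pts (A k)" for k a
    using that by (force simp: I_def)
  have I: "I \<subseteq> pts S" "\<And>t g. t \<in> I \<Longrightarrow> g \<in> carrier G \<Longrightarrow> ract S t g \<in> I"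
  proof -
    show "I \<subseteq> pts S" using i by (auto simp: I_def equivariant_maps_iff)
    fix t g assume "t \<in> I" and g: "g \<in> carrier G"
    then obtain k a where k: "k < n" "a \<in> pts (A k)" "t = i k a" by (auto simp: I_def)
    then have "ract S t g = i k (ract (A k) a g)" using i g by (simp add: equivariant_maps_iff)
    then show "ract S t g \<in> I" using k g DA by (simp add: iI)
  qed
  obtain T :: "('g, 'a) rset" and u v where T: "fin_free_rset G T"
    and u: "u \<in> equivariant_maps G S T" and v: "v \<in> equivariant_maps G S T"
    and uv: "\<And>t. t \<in> pts S \<Longrightarrow> u t = v t \<longleftrightarrow> t \<in> I"
    using separating_maps[OF inf G S I] by blast
  have "u (i k a) = v (i k a)" if "k < n" "a \<in> pts (A k)" for k a
    using uv iI[OF that] I(1) by blast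
  then have "compose (pts (A k)) u (i k) = compose (pts (A k)) v (i k)" if "k < n" for k
    using that by (auto simp: compose_def restrict_def)
  moreover have "compose (pts (A k)) u (i k) \<in> equivariant_maps G (A k) T" if "k < n" for k
    by (rule equivariant_maps_compose[OF A[OF that] i[OF that] u])
  ultimately have "u = v"
    using univ[OF T, of "\<lambda>k. compose (pts (A k)) u (i k)"] u v by (metis (no_types, lifting))
  then have "I = pts S" using I(1) uv by blast
  then show ?rhs using S A i inj by (simp add: bij_betw_def I_def)
next
  assume ?rhs
  then have S: "fin_free_rset G S" and A: "\<And>k. k < n \<Longrightarrow> fin_free_rset G (A k)"
    and i: "\<And>k. k < n \<Longrightarrow> i k \<in> equivariant_maps G (A k) S"
    and bij: "bij_betw (\<lambda>(k, a). i k a) (SIGMA k:{..<n}. pts (A k)) (pts S)"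
    by auto
  note DA = fin_free_rsetD[OF A]
  have onto: "\<exists>k a. k < n \<and> a \<in> pts (A k) \<and> s = i k a" if "s \<in> pts S" for s
    using bij that unfolding bij_betw_def by force
  define c where "c = inv_into (SIGMA k:{..<n}. pts (A k)) (\<lambda>(k, a). i k a)"
  have c: "c (i k a) = (k, a)" if "k < n" "a \<in> pts (A k)" for k a
    unfolding c_def using inv_into_f_f[OF bij_betw_imp_inj_on[OF bij], of "(k, a)"] that by simp
  have "\<exists>!w. w \<in> equivariant_maps G S T \<and> (\<forall>k<n. compose (pts (A k)) w (i k) = j k)"
    if T: "fin_free_rset G T" and j: "\<And>k. k < n \<Longrightarrow> j k \<in> equivariant_maps G (A k) T"
    for T :: "('g, 'a) rset" and j
  proof (rule ex_ex1I)
    define w where "w = (\<lambda>s\<in>pts S. j (fst (c s)) (snd (c s)))"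
    have iS: "i k a \<in> pts S" if "k < n" "a \<in> pts (A k)" for k a
      using i that by (simp add: equivariant_maps_iff)
    have w: "w (i k a) = j k a" if "k < n" "a \<in> pts (A k)" for k a
      using that by (simp add: w_def c iS)
    have "w s \<in> pts T \<and> (\<forall>g\<in>carrier G. w (ract S s g) = ract T (w s) g)" if s: "s \<in> pts S" for s
    proof -
      obtain k a where k: "k < n" and a: "a \<in> pts (A k)" and s: "s = i k a" using onto[OF s] by blast
      have "ract S s g = i k (ract (A k) a g)" if "g \<in> carrier G" for g
        using i[OF k] a s that by (simp add: equivariant_maps_iff)
      then show ?thesis
        using j[OF k] a s by (simp add: w[OF k] DA[OF k] equivariant_maps_iff)
    qed
    then have "w \<in> equivariant_maps G S T" by (simp add: equivariant_maps_iff w_def)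
    moreover have "compose (pts (A k)) w (i k) = j k" if "k < n" for k
      using j[OF that] w[OF that]
      by (intro extensionalityI[of _ "pts (A k)"]) (auto simp: equivariant_maps_iff compose_eq)
    ultimately show "\<exists>w. w \<in> equivariant_maps G S T \<and> (\<forall>k<n. compose (pts (A k)) w (i k) = j k)"
      by blast
  next
    fix w w'
    assume w: "w \<in> equivariant_maps G S T \<and> (\<forall>k<n. compose (pts (A k)) w (i k) = j k)"
      and w': "w' \<in> equivariant_maps G S T \<and> (\<forall>k<n. compose (pts (A k)) w' (i k) = j k)"
    show "w = w'"
    proof (rule equivariant_maps_eqI)
      show "w \<in> equivariant_maps G S T" "w' \<in> equivariant_maps G S T" using w w' by auto
      fix s assume "s \<in> pts S"
      then obtain k a where "k < n" "a \<in> pts (A k)" "s = i k a" using onto by blast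
      then show "w s = w' s" using w w' by (metis compose_eq)
    qed
  qed
  then show ?co using S A i unfolding is_coproduct_def by simp
qed

section \<open>Presentations of \<open>F S\<close> as a quotient of \<open>S \<times> X\<close>\<close>

lemma is_functorD:
  assumes "is_functor (FinCat G) (FinCat H) F" and "fin_free_rset G S"
  shows "fin_free_rset H (fobj F S)"
    and "y \<in> pts (fobj F S) \<Longrightarrow> fmap F S S (\<lambda>s\<in>pts S. s) y = y"
    and "fin_free_rset G T \<Longrightarrow> f \<in> equivariant_maps G S T \<Longrightarrow>
      fmap F S T f \<in> equivariant_maps H (fobj F S) (fobj F T)"
    and "fin_free_rset G T \<Longrightarrow> fin_free_rset G U \<Longrightarrow> f \<in> equivariant_maps G S T \<Longrightarrow>
      g \<in> equivariant_maps G T U \<Longrightarrow> y \<in> pts (fobj F S) \<Longrightarrow>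
      fmap F S U (compose (pts S) g f) y = fmap F T U g (fmap F S T f y)"
  using assms by (simp_all add: is_functor_def compose_eq)

text \<open>Here \<open>P S s x\<close> plays the part of the class \<open>[s, x]\<close>, with values in \<open>F S\<close> itself. Such a \<open>P\<close> is
  the same thing as a natural isomorphism from \<open>F\<close> to the tensor functor, in a form in which one can
  compute with elements of \<open>F S\<close> instead of equivalence classes.\<close>

locale tensor_presentation =
  fixes G :: "('g, 'm) monoid_scheme" and H :: "('h, 'n) monoid_scheme"
    and F :: "(('g, 'a) rset, 'a \<Rightarrow> 'a, ('h, 'b) rset, 'b \<Rightarrow> 'b) funct"
    and X :: "('g, 'h, 'x) biset"
    and P :: "('g, 'a) rset \<Rightarrow> 'a \<Rightarrow> 'x \<Rightarrow> 'b"
  assumes G: "group G" and H: "group H" and F: "is_functor (FinCat G) (FinCat H) F"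
    and X: "fin_biset G H X"
    and pts_fobj: "fin_free_rset G S \<Longrightarrow> pts (fobj F S) = {P S s x | s x. s \<in> pts S \<and> x \<in> pts X}"
    and P_eq_iff: "fin_free_rset G S \<Longrightarrow> s \<in> pts S \<Longrightarrow> x \<in> pts X \<Longrightarrow> s' \<in> pts S \<Longrightarrow> x' \<in> pts X \<Longrightarrow>
      P S s x = P S s' x' \<longleftrightarrow> (\<exists>g\<in>carrier G. s = ract S s' g \<and> x' = lact X g x)"
    and ract_P: "fin_free_rset G S \<Longrightarrow> s \<in> pts S \<Longrightarrow> x \<in> pts X \<Longrightarrow> h \<in> carrier H \<Longrightarrow>
      ract (fobj F S) (P S s x) h = P S s (ract X x h)"
    and fmap_P: "fin_free_rset G S \<Longrightarrow> fin_free_rset G T \<Longrightarrow> f \<in> equivariant_maps G S T \<Longrightarrow>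
      s \<in> pts S \<Longrightarrow> x \<in> pts X \<Longrightarrow> fmap F S T f (P S s x) = P T (f s) x"
begin

lemma P_in: "fin_free_rset G S \<Longrightarrow> s \<in> pts S \<Longrightarrow> x \<in> pts X \<Longrightarrow> P S s x \<in> pts (fobj F S)"
  by (auto simp: pts_fobj)

lemma P_cases:
  assumes "fin_free_rset G S" "y \<in> pts (fobj F S)"
  obtains s x where "s \<in> pts S" "x \<in> pts X" "y = P S s x"
  using assms by (auto simp: pts_fobj)

lemma naturally_isomorphic_tensor_functor: "naturally_isomorphic G H F (tensor_functor G H X)"
proof -
  note sets = fin_free_rsetD(2)
  \<comment> \<open>The fibres of \<open>P S\<close> are the classes of \<open>tensor_rel\<close>.\<close>
  define \<eta> where "\<eta> S = (\<lambda>y\<in>pts (fobj F S). {(s, x). s \<in> pts S \<and> x \<in> pts X \<and> P S s x = y})" for S :: "('g, 'a) rset"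
  have \<eta>_P: "\<eta> S (P S s x) = tensor_rel G S X `` {(s, x)}"
    if S: "fin_free_rset G S" and s: "s \<in> pts S" and x: "x \<in> pts X" for S :: "('g, 'a) rset" and s x
  proof -
    have "P S s' x' = P S s x \<longleftrightarrow> (\<exists>g\<in>carrier G. s = ract S s' g \<and> x' = lact X g x)"
      if "s' \<in> pts S" "x' \<in> pts X" for s' x'
      using P_eq_iff[OF S s x that] by metis
    then show ?thesis
      using P_in[OF S s x] x lact_facts(1)[OF G X] by (auto simp: \<eta>_def tensor_rel_iff) blast
  qed
  have "equivariant_iso H (fobj F S) (tensor G H S X) (\<eta> S)" if S: "fin_free_rset G S" for S :: "('g, 'a) rset"
  proof -
    note T = tensor_facts[OF G sets[OF S] X]
    have xh: "ract X x h \<in> pts X" if "x \<in> pts X" "h \<in> carrier H" for x h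
      using X that by (simp add: fin_biset_def fin_free_rset_def right_action_def)
    have "\<eta> S \<in> equivariant_maps H (fobj F S) (tensor G H S X)"
      unfolding equivariant_maps_iff
    proof (intro conjI ballI)
      show "\<eta> S \<in> extensional (pts (fobj F S))" by (simp add: \<eta>_def)
      fix y assume "y \<in> pts (fobj F S)"
      then obtain s x where y: "s \<in> pts S" "x \<in> pts X" "y = P S s x" using S by (elim P_cases)
      then show "\<eta> S y \<in> pts (tensor G H S X)" using T(1) \<eta>_P[OF S] by auto
      fix h assume "h \<in> carrier H"
      then show "\<eta> S (ract (fobj F S) y h) = ract (tensor G H S X) (\<eta> S y) h"
        using y xh by (simp add: ract_P[OF S] \<eta>_P[OF S] T(2))
    qed
    moreover have "bij_betw (\<eta> S) (pts (fobj F S)) (pts (tensor G H S X))"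
    proof (rule bij_betw_imageI)
      show "inj_on (\<eta> S) (pts (fobj F S))"
        by (auto intro!: inj_onI simp: pts_fobj[OF S] \<eta>_P[OF S] T(3) P_eq_iff[OF S])
      show "\<eta> S ` pts (fobj F S) = pts (tensor G H S X)"
        by (force simp: pts_fobj[OF S] \<eta>_P[OF S] T(1))
    qed
    ultimately show ?thesis
      using is_functorD(1)[OF F S] by (simp add: equivariant_iso_iff_bij_betw fin_free_rsetD)
  qed
  moreover have "\<eta> T (fmap F S T f y) = fmap (tensor_functor G H X) S T f (\<eta> S y)"
    if S: "fin_free_rset G S" and T: "fin_free_rset G T" and f: "f \<in> equivariant_maps G S T"
      and y: "y \<in> pts (fobj F S)" for S T :: "('g, 'a) rset" and f y
  proof -
    obtain s x where y: "s \<in> pts S" "x \<in> pts X" "y = P S s x" using S y by (rule P_cases)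
    moreover have "f s \<in> pts T" using f y by (simp add: equivariant_maps_iff)
    ultimately show ?thesis
      by (simp add: fmap_P[OF S T f] \<eta>_P[OF S] \<eta>_P[OF T] tensor_functor_map[OF G S T X f])
  qed
  ultimately show ?thesis
    unfolding naturally_isomorphic_def by (intro exI[of _ \<eta>]) (simp add: tensor_functor_def)
qed

end

text \<open>With a natural isomorphism \<open>\<eta>\<close> given, \<open>P S s x\<close> is the point that \<open>\<eta> S\<close> sends to \<open>[s, x]\<close>.\<close>

lemma tensor_presentation_exists:
  fixes F :: "(('g, 'a) rset, 'a \<Rightarrow> 'a, ('h, 'b) rset, 'b \<Rightarrow> 'b) funct"
    and X :: "('g, 'h, 'x) biset"
  assumes G: "group G" and H: "group H" and F: "is_functor (FinCat G) (FinCat H) F"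
    and X: "fin_biset G H X" and iso: "naturally_isomorphic G H F (tensor_functor G H X)"
  obtains P where "tensor_presentation G H F X P"
proof -
  have fobj_tensor: "fobj (tensor_functor G H X) S = tensor G H S X" for S :: "('g, 'a) rset"
    by (simp add: tensor_functor_def)
  obtain \<eta> where iso: "\<And>S :: ('g, 'a) rset. fin_free_rset G S \<Longrightarrow> equivariant_iso H (fobj F S) (tensor G H S X) (\<eta> S)"
    and nat: "\<And>(S :: ('g, 'a) rset) (T :: ('g, 'a) rset) f y. fin_free_rset G S \<Longrightarrow> fin_free_rset G T \<Longrightarrow> f \<in> equivariant_maps G S T \<Longrightarrow>
      y \<in> pts (fobj F S) \<Longrightarrow> \<eta> T (fmap F S T f y) = fmap (tensor_functor G H X) S T f (\<eta> S y)"
    using iso unfolding naturally_isomorphic_def FinCat_simps mem_Collect_eq fobj_tensor by blast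
  have equiv: "\<eta> S \<in> equivariant_maps H (fobj F S) (tensor G H S X)"
    and bij: "bij_betw (\<eta> S) (pts (fobj F S)) (pts (tensor G H S X))" if "fin_free_rset G S" for S :: "('g, 'a) rset"
    using iso[OF that] is_functorD(1)[OF F that]
    by (simp_all add: equivariant_iso_iff_bij_betw fin_free_rsetD)
  note T = tensor_facts[OF G fin_free_rsetD(2) X]
  define P where "P S s x = inv_into (pts (fobj F S)) (\<eta> S) (tensor_rel G S X `` {(s, x)})" for S :: "('g, 'a) rset" and s x
  have P: "P S s x \<in> pts (fobj F S)" "\<eta> S (P S s x) = tensor_rel G S X `` {(s, x)}"
    if S: "fin_free_rset G S" and "s \<in> pts S" "x \<in> pts X" for S :: "('g, 'a) rset" and s x
  proof -
    have "tensor_rel G S X `` {(s, x)} \<in> \<eta> S ` pts (fobj F S)"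
      using bij[OF S] that T(1)[OF S] by (auto simp: bij_betw_def)
    then show "P S s x \<in> pts (fobj F S)" "\<eta> S (P S s x) = tensor_rel G S X `` {(s, x)}"
      by (simp_all add: P_def inv_into_into f_inv_into_f)
  qed
  have eqI: "y = P S s x"
    if "fin_free_rset G S" "s \<in> pts S" "x \<in> pts X" "y \<in> pts (fobj F S)"
      "\<eta> S y = tensor_rel G S X `` {(s, x)}" for S :: "('g, 'a) rset" and s x y
    using bij[OF that(1)] that P[OF that(1-3)] by (auto simp: bij_betw_def inj_on_def)
  have xh: "ract X x h \<in> pts X" if "x \<in> pts X" "h \<in> carrier H" for x h
    using X that by (simp add: fin_biset_def fin_free_rset_def right_action_def)
  have "tensor_presentation G H F X P"
  proof (rule tensor_presentation.intro; (rule G H F X)?)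
    fix S :: "('g, 'a) rset" assume S: "fin_free_rset G S"
    note FS = fin_free_rsetD[OF is_functorD(1)[OF F S]]
    show "pts (fobj F S) = {P S s x | s x. s \<in> pts S \<and> x \<in> pts X}"
    proof (intro equalityI subsetI)
      fix y assume y: "y \<in> pts (fobj F S)"
      then have "\<eta> S y \<in> pts (tensor G H S X)" using bij[OF S] by (auto simp: bij_betw_def)
      then obtain s x where "s \<in> pts S" "x \<in> pts X" "\<eta> S y = tensor_rel G S X `` {(s, x)}"
        by (auto simp: T(1)[OF S])
      then show "y \<in> {P S s x | s x. s \<in> pts S \<and> x \<in> pts X}" using eqI[OF S] y by blast
    qed (auto simp: P(1)[OF S])
    fix s x assume s: "s \<in> pts S" and x: "x \<in> pts X"
    show "P S s x = P S s' x' \<longleftrightarrow> (\<exists>g\<in>carrier G. s = ract S s' g \<and> x' = lact X g x)"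
      if "s' \<in> pts S" "x' \<in> pts X" for s' x'
      using T(3)[OF S s x that] P[OF S] s x that eqI[OF S] by metis
    show "ract (fobj F S) (P S s x) h = P S s (ract X x h)" if "h \<in> carrier H" for h
      using s x that xh P[OF S s x] FS equiv[OF S]
      by (intro eqI[OF S]) (simp_all add: equivariant_maps_iff T(2)[OF S])
    show "fmap F S U f (P S s x) = P U (f s) x"
      if U: "fin_free_rset G U" and f: "f \<in> equivariant_maps G S U" for U :: "('g, 'a) rset" and f
    proof (rule eqI[OF U _ x])
      show "f s \<in> pts U" using f s by (simp add: equivariant_maps_iff)
      show "fmap F S U f (P S s x) \<in> pts (fobj F U)"
        using is_functorD(3)[OF F S U f] P[OF S s x] by (simp add: equivariant_maps_iff)
      show "\<eta> U (fmap F S U f (P S s x)) = tensor_rel G U X `` {(f s, x)}"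
        using nat[OF S U f P(1)[OF S s x]] tensor_functor_map[OF G S U X f s x] P[OF S s x] by simp
    qed
  qed
  then show ?thesis by (rule that)
qed

section \<open>Tensoring preserves epimorphisms, pullbacks and coproducts\<close>

context tensor_presentation
begin

lemma preserves_epis_of_presentation:
  assumes inf: "infinite (UNIV :: 'a set)" "infinite (UNIV :: 'b set)"
  shows "preserves_epis (FinCat G) (FinCat H) F"
  unfolding preserves_epis_def is_epi_FinCat_iff[OF inf(1) G] is_epi_FinCat_iff[OF inf(2) H]
proof (intro allI impI; elim conjE)
  fix S T :: "('g, 'a) rset" and f assume S: "fin_free_rset G S" and T: "fin_free_rset G T"
    and f: "f \<in> equivariant_maps G S T" and onto: "f ` pts S = pts T"
  note Ff = is_functorD(3)[OF F S T f]
  have "y \<in> fmap F S T f ` pts (fobj F S)" if y: "y \<in> pts (fobj F T)" for y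
  proof -
    obtain t x where t: "t \<in> pts T" and x: "x \<in> pts X" and y: "y = P T t x"
      using T y by (rule P_cases)
    obtain s where "s \<in> pts S" "t = f s" using t onto by auto
    then show ?thesis using x y fmap_P[OF S T f] P_in[OF S] by (metis imageI)
  qed
  then show "fin_free_rset H (fobj F S) \<and> fin_free_rset H (fobj F T) \<and>
      fmap F S T f \<in> equivariant_maps H (fobj F S) (fobj F T) \<and>
      fmap F S T f ` pts (fobj F S) = pts (fobj F T)"
    using is_functorD(1)[OF F] S T Ff by (auto simp: equivariant_maps_iff)
qed

text \<open>A point of the pullback of \<open>F A\<close> and \<open>F B\<close> can be written as \<open>([a, x], [b, x])\<close> with the same \<open>x\<close>
  and \<open>f a = g b\<close>. Injectivity is where freeness over \<open>C\<close> enters: the group elements that identify the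
  two components agree because they act in the same way on a point of \<open>C\<close>.\<close>

lemma preserves_pullbacks_of_presentation:
  assumes inf: "infinite (UNIV :: 'a set)" "infinite (UNIV :: 'b set)"
    and fin: "finite (carrier G)" "finite (carrier H)"
  shows "preserves_pullbacks (FinCat G) (FinCat H) F"
  unfolding preserves_pullbacks_def is_pullback_FinCat_iff[OF inf(1) G fin(1)]
    is_pullback_FinCat_iff[OF inf(2) H fin(2)]
proof (intro allI impI; elim conjE)
  fix Q A B C :: "('g, 'a) rset" and p q f g
  assume Q: "fin_free_rset G Q" and A: "fin_free_rset G A" and B: "fin_free_rset G B"
    and C: "fin_free_rset G C"
    and p: "p \<in> equivariant_maps G Q A" and q: "q \<in> equivariant_maps G Q B"
    and f: "f \<in> equivariant_maps G A C" and g: "g \<in> equivariant_maps G B C"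
    and bij: "bij_betw (\<lambda>z. (p z, q z)) (pts Q) {(a, b). a \<in> pts A \<and> b \<in> pts B \<and> f a = g b}"
  have inj: "z = z'" if "z \<in> pts Q" "z' \<in> pts Q" "p z = p z'" "q z = q z'" for z z'
    using bij that by (auto simp: bij_betw_def inj_on_def)
  have surj: "\<exists>z\<in>pts Q. p z = a \<and> q z = b" if "a \<in> pts A" "b \<in> pts B" "f a = g b" for a b
  proof -
    have "(a, b) \<in> (\<lambda>z. (p z, q z)) ` pts Q" using bij that by (simp add: bij_betw_def)
    then show ?thesis by auto
  qed
  have comm: "f (p z) = g (q z)" if "z \<in> pts Q" for z
  proof -
    have "(p z, q z) \<in> {(a, b). a \<in> pts A \<and> b \<in> pts B \<and> f a = g b}"
      using bij that by (auto simp: bij_betw_def)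
    then show ?thesis by auto
  qed
  have mem: "\<And>z. z \<in> pts Q \<Longrightarrow> p z \<in> pts A" "\<And>z. z \<in> pts Q \<Longrightarrow> q z \<in> pts B"
    "\<And>a. a \<in> pts A \<Longrightarrow> f a \<in> pts C" "\<And>b. b \<in> pts B \<Longrightarrow> g b \<in> pts C"
    using p q f g by (simp_all add: equivariant_maps_iff)
  note Fp = fmap_P[OF Q A p] and Fq = fmap_P[OF Q B q] and Ff = fmap_P[OF A C f]
    and Fg = fmap_P[OF B C g]
  let ?Fp = "fmap F Q A p" and ?Fq = "fmap F Q B q" and ?Ff = "fmap F A C f" and ?Fg = "fmap F B C g"
  have "bij_betw (\<lambda>y. (?Fp y, ?Fq y)) (pts (fobj F Q))
    {(a, b). a \<in> pts (fobj F A) \<and> b \<in> pts (fobj F B) \<and> ?Ff a = ?Fg b}"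
    unfolding bij_betw_def
  proof (intro conjI inj_onI equalityI subsetI)
    fix y y' assume y: "y \<in> pts (fobj F Q)" and y': "y' \<in> pts (fobj F Q)"
      and eq: "(?Fp y, ?Fq y) = (?Fp y', ?Fq y')"
    obtain z x where z: "z \<in> pts Q" "x \<in> pts X" "y = P Q z x" using Q y by (rule P_cases)
    obtain z' x' where z': "z' \<in> pts Q" "x' \<in> pts X" "y' = P Q z' x'" using Q y' by (rule P_cases)
    have "P A (p z) x = P A (p z') x'" "P B (q z) x = P B (q z') x'"
      using eq z z' by (simp_all add: Fp Fq)
    then obtain k l where k: "k \<in> carrier G" "p z = ract A (p z') k" "x' = lact X k x"
      and l: "l \<in> carrier G" "q z = ract B (q z') l"
      using P_eq_iff[OF A] P_eq_iff[OF B] z z' mem by metis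
    \<comment> \<open>\<open>k\<close> and \<open>l\<close> move \<open>f (p z') = g (q z')\<close> to the same point of the free \<open>C\<close>.\<close>
    have "ract C (f (p z')) k = f (p z)" using f k z' mem by (simp add: equivariant_maps_iff)
    also have "\<dots> = ract C (f (p z')) l"
      using g l z z' mem comm by (simp add: equivariant_maps_iff)
    finally have "k = l" using free_action_cancel[OF G C] k(1) l(1) z' mem by metis
    then have "p z = p (ract Q z' k)" "q z = q (ract Q z' k)" "ract Q z' k \<in> pts Q"
      using k l z' p q fin_free_rsetD(4)[OF Q] by (simp_all add: equivariant_maps_iff)
    then have "z = ract Q z' k" using z by (intro inj[of z "ract Q z' k"])
    then show "y = y'" using P_eq_iff[OF Q z(1,2) z'(1,2)] k z z' by blast
  next
    fix c assume "c \<in> (\<lambda>y. (?Fp y, ?Fq y)) ` pts (fobj F Q)"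
    then obtain y where y: "y \<in> pts (fobj F Q)" and c: "c = (?Fp y, ?Fq y)" by auto
    obtain z x where "z \<in> pts Q" "x \<in> pts X" "y = P Q z x" using Q y by (rule P_cases)
    with c show "c \<in> {(a, b). a \<in> pts (fobj F A) \<and> b \<in> pts (fobj F B) \<and> ?Ff a = ?Fg b}"
      using comm by (simp add: Fp Fq Ff Fg mem P_in A B)
  next
    fix c assume "c \<in> {(a, b). a \<in> pts (fobj F A) \<and> b \<in> pts (fobj F B) \<and> ?Ff a = ?Fg b}"
    then obtain y y' where c: "c = (y, y')" and y: "y \<in> pts (fobj F A)" and y': "y' \<in> pts (fobj F B)"
      and eq: "?Ff y = ?Fg y'" by auto
    obtain a x where a: "a \<in> pts A" "x \<in> pts X" "y = P A a x" using A y by (rule P_cases)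
    obtain b x' where b: "b \<in> pts B" "x' \<in> pts X" "y' = P B b x'" using B y' by (rule P_cases)
    have "P C (f a) x = P C (g b) x'" using eq a b by (simp add: Ff Fg)
    then obtain k where k: "k \<in> carrier G" "f a = ract C (g b) k" "x' = lact X k x"
      using P_eq_iff[OF C] a b mem by metis
    \<comment> \<open>Moving \<open>k\<close> across the tensor sign gives \<open>[b, x'] = [b, k x] = [b k, x]\<close>.\<close>
    define b' where "b' = ract B b k"
    have b': "b' \<in> pts B" "g b' = f a" "P B b' x = y'"
      using b k g fin_free_rsetD(4)[OF B] a P_eq_iff[OF B _ a(2) b(1,2), of b']
      by (auto simp: b'_def equivariant_maps_iff)
    obtain z where "z \<in> pts Q" "p z = a" "q z = b'" using surj[of a b'] a b' by auto
    then have "(?Fp (P Q z x), ?Fq (P Q z x)) = c" using a b' c by (simp add: Fp Fq)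
    then show "c \<in> (\<lambda>y. (?Fp y, ?Fq y)) ` pts (fobj F Q)"
      using P_in[OF Q \<open>z \<in> pts Q\<close> a(2)] by blast
  qed
  then show "fin_free_rset H (fobj F Q) \<and> fin_free_rset H (fobj F A) \<and>
      fin_free_rset H (fobj F B) \<and> fin_free_rset H (fobj F C) \<and>
      ?Fp \<in> equivariant_maps H (fobj F Q) (fobj F A) \<and> ?Fq \<in> equivariant_maps H (fobj F Q) (fobj F B) \<and>
      ?Ff \<in> equivariant_maps H (fobj F A) (fobj F C) \<and> ?Fg \<in> equivariant_maps H (fobj F B) (fobj F C) \<and>
      bij_betw (\<lambda>y. (?Fp y, ?Fq y)) (pts (fobj F Q))
        {(a, b). a \<in> pts (fobj F A) \<and> b \<in> pts (fobj F B) \<and> ?Ff a = ?Fg b}"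
    using is_functorD(1,3)[OF F] Q A B C p q f g by blast
qed

text \<open>If \<open>[i k a, x]\<close> and \<open>[i l b, x']\<close> coincide, then \<open>i k a\<close> and \<open>i l b\<close> differ by an element of \<open>G\<close>, so
  they lie in the same summand and the classes coincide already there.\<close>

lemma preserves_finite_coproducts_of_presentation:
  assumes inf: "infinite (UNIV :: 'a set)" "infinite (UNIV :: 'b set)"
  shows "preserves_finite_coproducts (FinCat G) (FinCat H) F"
  unfolding preserves_finite_coproducts_def is_coproduct_FinCat_iff[OF inf(1) G]
    is_coproduct_FinCat_iff[OF inf(2) H]
proof (intro allI impI; elim conjE)
  fix n i and A :: "nat \<Rightarrow> ('g, 'a) rset" and S :: "('g, 'a) rset"
  assume S: "fin_free_rset G S" and Ai: "\<forall>k<n. fin_free_rset G (A k) \<and> i k \<in> equivariant_maps G (A k) S"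
    and bij: "bij_betw (\<lambda>(k, a). i k a) (SIGMA k:{..<n}. pts (A k)) (pts S)"
  have A: "fin_free_rset G (A k)" and i: "i k \<in> equivariant_maps G (A k) S" if "k < n" for k
    using Ai that by auto
  have mem: "ract S (i k a) g = i k (ract (A k) a g)" "ract (A k) a g \<in> pts (A k)"
    if "k < n" "a \<in> pts (A k)" "g \<in> carrier G" for k a g
    using i[OF that(1)] fin_free_rsetD(4)[OF A[OF that(1)]] that(2,3)
    by (auto simp: equivariant_maps_iff)
  have iS: "i k a \<in> pts S" if "k < n" "a \<in> pts (A k)" for k a
    using i[OF that(1)] that by (simp add: equivariant_maps_iff)
  have inj: "k = l \<and> a = b"
    if "k < n" "l < n" "a \<in> pts (A k)" "b \<in> pts (A l)" "i k a = i l b" for k l a b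
    using inj_onD[OF bij_betw_imp_inj_on[OF bij], of "(k, a)" "(l, b)"] that by simp
  have surj: "\<exists>k a. k < n \<and> a \<in> pts (A k) \<and> s = i k a" if "s \<in> pts S" for s
    using bij that unfolding bij_betw_def by force
  let ?Fi = "\<lambda>k. fmap F (A k) S (i k)"
  have Fi: "?Fi k (P (A k) a x) = P S (i k a) x" if "k < n" "a \<in> pts (A k)" "x \<in> pts X" for k a x
    using fmap_P[OF A[OF that(1)] S i[OF that(1)]] that by simp
  have "bij_betw (\<lambda>(k, y). ?Fi k y) (SIGMA k:{..<n}. pts (fobj F (A k))) (pts (fobj F S))"
  proof (rule bij_betw_imageI)
    have "k = l \<and> y = y'" if k: "k < n" and l: "l < n" and y: "y \<in> pts (fobj F (A k))"
      and y': "y' \<in> pts (fobj F (A l))" and eq: "?Fi k y = ?Fi l y'" for k l y y'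
    proof -
      obtain a x where a: "a \<in> pts (A k)" "x \<in> pts X" "y = P (A k) a x"
        using A[OF k] y by (rule P_cases)
      obtain b x' where b: "b \<in> pts (A l)" "x' \<in> pts X" "y' = P (A l) b x'"
        using A[OF l] y' by (rule P_cases)
      have "P S (i k a) x = P S (i l b) x'" using eq a b k l by (simp add: Fi)
      then obtain g where g: "g \<in> carrier G" "i k a = ract S (i l b) g" "x' = lact X g x"
        using P_eq_iff[OF S] a b iS k l by metis
      then have "k = l \<and> a = ract (A l) b g" using inj[OF k l a(1)] mem[OF l b(1) g(1)] by simp
      then show ?thesis using P_eq_iff[OF A[OF l]] a b g by blast
    qed
    then show "inj_on (\<lambda>(k, y). ?Fi k y) (SIGMA k:{..<n}. pts (fobj F (A k)))"
      by (auto intro!: inj_onI)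
    have "?Fi k y \<in> pts (fobj F S)" if "k < n" "y \<in> pts (fobj F (A k))" for k y
      using is_functorD(3)[OF F A[OF that(1)] S i[OF that(1)]] that
      by (simp add: equivariant_maps_iff)
    moreover have "\<exists>k y. k < n \<and> y \<in> pts (fobj F (A k)) \<and> ?Fi k y = y'" if y': "y' \<in> pts (fobj F S)" for y'
    proof -
      obtain s x where s: "s \<in> pts S" "x \<in> pts X" "y' = P S s x" using S y' by (rule P_cases)
      obtain k a where "k < n" "a \<in> pts (A k)" "s = i k a" using surj[OF s(1)] by blast
      then show ?thesis using s Fi P_in[OF A] by metis
    qed
    ultimately show "(\<lambda>(k, y). ?Fi k y) ` (SIGMA k:{..<n}. pts (fobj F (A k))) = pts (fobj F S)"
      by force
  qed
  then show "fin_free_rset H (fobj F S) \<and>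
      (\<forall>k<n. fin_free_rset H (fobj F (A k)) \<and> ?Fi k \<in> equivariant_maps H (fobj F (A k)) (fobj F S)) \<and>
      bij_betw (\<lambda>(k, y). ?Fi k y) (SIGMA k:{..<n}. pts (fobj F (A k))) (pts (fobj F S))"
    using is_functorD(1,3)[OF F] S A i by blast
qed

end

section \<open>Coproduct-preserving functors are tensor products\<close>

text \<open>The library's actions are homomorphisms into the group of extensional bijections; invertibility
  of \<open>\<phi> g\<close> comes for free from \<open>\<phi> (inv g)\<close>.\<close>

lemma group_actionI:
  assumes G: "group G"
    and ext: "\<And>g. g \<in> carrier G \<Longrightarrow> \<phi> g \<in> extensional A"
    and closed: "\<And>g x. g \<in> carrier G \<Longrightarrow> x \<in> A \<Longrightarrow> \<phi> g x \<in> A"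
    and one: "\<And>x. x \<in> A \<Longrightarrow> \<phi> \<one>\<^bsub>G\<^esub> x = x"
    and mult: "\<And>g k x. g \<in> carrier G \<Longrightarrow> k \<in> carrier G \<Longrightarrow> x \<in> A \<Longrightarrow> \<phi> (g \<otimes>\<^bsub>G\<^esub> k) x = \<phi> g (\<phi> k x)"
  shows "group_action G A \<phi>"
proof -
  interpret group G by (rule G)
  have Bij: "\<phi> g \<in> Bij A" if g: "g \<in> carrier G" for g
  proof -
    have "bij_betw (\<phi> g) A A"
      using g one closed by (intro bij_betw_byWitness[of _ "\<phi> (inv\<^bsub>G\<^esub> g)"]) (auto simp flip: mult)
    then show ?thesis using ext[OF g] by (simp add: Bij_def)
  qed
  have "\<phi> (g \<otimes>\<^bsub>G\<^esub> k) = compose A (\<phi> g) (\<phi> k)" if "g \<in> carrier G" "k \<in> carrier G" for g k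
    using that ext mult by (intro extensionalityI[of _ A]) (auto simp: compose_eq)
  then have "\<phi> \<in> hom G (BijGroup A)"
    using Bij by (auto simp: hom_def BijGroup_def)
  then show ?thesis
    unfolding group_action_def
    by (intro group_hom.intro group_hom_axioms.intro G group_BijGroup)
qed

context regular_rset
begin

text \<open>A free \<open>G\<close>-set is the disjoint union of its orbits, and the orbit of a representative is a copy
  of the regular \<open>G\<close>-set.\<close>

lemma coproduct_of_orbits:
  assumes inf: "infinite (UNIV :: 'a set)" and S: "fin_free_rset G S"
  obtains n :: nat and r where "\<And>k. k < n \<Longrightarrow> r k \<in> pts S"
    "is_coproduct (FinCat G) n (\<lambda>_. R) S (\<lambda>k. orbit_map S (r k))"
proof -
  note D = fin_free_rsetD[OF S]
  define orb where "orb s = ract S s ` carrier G" for s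
  define rep where "rep s = (SOME t. t \<in> orb s)" for s
  have self: "s \<in> orb s" if "s \<in> pts S" for s
    using that D(5)[OF that] unfolding orb_def by (metis image_eqI one_closed)
  have orb_ract: "orb (ract S s g) = orb s" if s: "s \<in> pts S" and g: "g \<in> carrier G" for s g
  proof (intro equalityI subsetI)
    fix t assume "t \<in> orb (ract S s g)"
    then obtain h where "h \<in> carrier G" "t = ract S (ract S s g) h" by (auto simp: orb_def)
    then have "h \<in> carrier G" "t = ract S s (g \<otimes>\<^bsub>G\<^esub> h)" using s g by (simp_all add: D)
    then show "t \<in> orb s" using g by (auto simp: orb_def)
  next
    fix t assume "t \<in> orb s"
    then obtain h where h: "h \<in> carrier G" "t = ract S s h" by (auto simp: orb_def)
    then have "t = ract S (ract S s g) (inv\<^bsub>G\<^esub> g \<otimes>\<^bsub>G\<^esub> h)"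
      using s g by (simp flip: D(6) m_assoc)
    then show "t \<in> orb (ract S s g)" using g h by (auto simp: orb_def)
  qed
  have rep: "rep s \<in> orb s" if "s \<in> pts S" for s
    unfolding rep_def by (rule someI[of _ s]) (rule self[OF that])
  have rep_pts: "rep s \<in> pts S" if "s \<in> pts S" for s
    using rep[OF that] that D(4) by (auto simp: orb_def)
  have orb_rep: "orb (rep s) = orb s" if s: "s \<in> pts S" for s
  proof -
    obtain g where "g \<in> carrier G" "rep s = ract S s g" using rep[OF s] by (auto simp: orb_def)
    then show ?thesis using orb_ract[OF s] by simp
  qed
  have rep_cong: "rep s = rep t" if "orb s = orb t" for s t
    using that by (simp add: rep_def)
  obtain r where r: "bij_betw r {..<card (rep ` pts S)} (rep ` pts S)"
    using ex_bij_betw_nat_finite[of "rep ` pts S"] D(1) by (auto simp: atLeast0LessThan)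
  let ?n = "card (rep ` pts S)"
  have r_in: "r k \<in> pts S" "rep (r k) = r k" if "k < ?n" for k
  proof -
    have "r k \<in> rep ` pts S" using r that by (auto simp: bij_betw_def)
    then obtain s where "s \<in> pts S" "r k = rep s" by auto
    then show "r k \<in> pts S" "rep (r k) = r k" using rep_pts rep_cong[OF orb_rep] by auto
  qed
  have "bij_betw (\<lambda>(k, a). orbit_map S (r k) a) (SIGMA k:{..<?n}. pts R) (pts S)"
  proof (rule bij_betw_imageI)
    have "k = l \<and> g = h" if k: "k < ?n" and l: "l < ?n" and g: "g \<in> carrier G" and h: "h \<in> carrier G"
      and eq: "ract S (r k) g = ract S (r l) h" for k l g h
    proof -
      have "orb (r k) = orb (r l)"
        using orb_ract[OF r_in(1)[OF k] g] orb_ract[OF r_in(1)[OF l] h] eq by simp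
      then have "r k = r l" using rep_cong r_in k l by metis
      then have "k = l" using r k l by (auto simp: bij_betw_def inj_on_def)
      then show ?thesis using free_action_cancel[OF G S r_in(1)[OF k] g h] eq by simp
    qed
    then show "inj_on (\<lambda>(k, a). orbit_map S (r k) a) (SIGMA k:{..<?n}. pts R)"
      by (auto intro!: inj_onI simp: pts_R; metis)
    have "orbit_map S (r k) a \<in> pts S" if "k < ?n" "a \<in> pts R" for k a
      using that r_in D(4) by (auto simp: pts_R)
    moreover have "\<exists>k a. k < ?n \<and> a \<in> pts R \<and> orbit_map S (r k) a = s" if s: "s \<in> pts S" for s
    proof -
      obtain k where k: "k < ?n" "r k = rep s" using r s unfolding bij_betw_def by force
      have "s \<in> orb (r k)" using self[OF s] orb_rep[OF s] k by simp
      then obtain g where "g \<in> carrier G" "s = ract S (r k) g" by (auto simp: orb_def)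
      then show ?thesis using k by (intro exI[of _ k] exI[of _ "e g"]) simp
    qed
    ultimately show "(\<lambda>(k, a). orbit_map S (r k) a) ` (SIGMA k:{..<?n}. pts R) = pts S"
      by force
  qed
  then have "is_coproduct (FinCat G) ?n (\<lambda>_. R) S (\<lambda>k. orbit_map S (r k))"
    using S R r_in orbit_map_arr[OF S] by (simp add: is_coproduct_FinCat_iff[OF inf G])
  with r_in(1) show ?thesis by (rule that)
qed

text \<open>The biset is \<open>X = F R\<close>, on which \<open>g\<close> acts through left multiplication on \<open>R\<close>, and the class
  \<open>[s, y]\<close> is presented by \<open>F\<close> of the orbit map of \<open>s\<close>, evaluated at \<open>y\<close>. Functoriality gives
  \<open>[s g, y] = [s, g y]\<close>. Since \<open>S\<close> is a coproduct of copies of \<open>R\<close>, one for each orbit representative,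
  every point of \<open>F S\<close> is \<open>[s, y]\<close> for a unique representative \<open>s\<close> and a unique \<open>y\<close>; moving group
  elements to the right shows that there are no identifications beyond the required ones.\<close>

lemma tensor_presentation_of_coproducts:
  fixes H :: "('h, 'n) monoid_scheme"
    and F :: "(('g, 'a) rset, 'a \<Rightarrow> 'a, ('h, 'b) rset, 'b \<Rightarrow> 'b) funct"
  assumes inf: "infinite (UNIV :: 'a set)" "infinite (UNIV :: 'b set)" "infinite (UNIV :: 'x set)"
    and H: "group H" and F: "is_functor (FinCat G) (FinCat H) F"
    and co: "preserves_finite_coproducts (FinCat G) (FinCat H) F"
  obtains X :: "('g, 'h, 'x) biset" and P where "tensor_presentation G H F X P"
proof -
  note F_ob = is_functorD(1)[OF F] and F_arr = is_functorD(3)[OF F] and F_comp = is_functorD(4)[OF F]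
  define Y where "Y = fobj F R"
  define \<Phi> where "\<Phi> S s y = fmap F R S (orbit_map S s) y" for S s y
  define L where "L g = \<Phi> R (e g)" for g
  note Y = fin_free_rsetD[OF F_ob[OF R], folded Y_def]
  have \<Phi>_arr: "\<Phi> S s \<in> equivariant_maps H Y (fobj F S)"
    if S: "fin_free_rset G S" and s: "s \<in> pts S" for S s
    using F_arr[OF R S orbit_map_arr[OF S s]] by (simp add: \<Phi>_def[abs_def] Y_def)
  have \<Phi>_in: "\<Phi> S s y \<in> pts (fobj F S)"
    if "fin_free_rset G S" "s \<in> pts S" "y \<in> pts Y" for S s y
    using \<Phi>_arr that by (simp add: equivariant_maps_iff)
  have fmap_\<Phi>: "fmap F S T f (\<Phi> S s y) = \<Phi> T (f s) y"
    if S: "fin_free_rset G S" and T: "fin_free_rset G T" and f: "f \<in> equivariant_maps G S T"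
      and s: "s \<in> pts S" and y: "y \<in> pts Y" for S T f s y
    using F_comp[OF R S T orbit_map_arr[OF S s] f] y compose_orbit_map[OF S T f s]
    by (simp add: \<Phi>_def Y_def)
  have \<Phi>_ract: "\<Phi> S (ract S s g) y = \<Phi> S s (L g y)"
    if S: "fin_free_rset G S" and s: "s \<in> pts S" and g: "g \<in> carrier G" and y: "y \<in> pts Y" for S s g y
    using fmap_\<Phi>[OF R S orbit_map_arr[OF S s] e_in[OF g] y] g by (simp add: L_def \<Phi>_def)
  have L_arr: "L g \<in> equivariant_maps H Y Y" if "g \<in> carrier G" for g
    using \<Phi>_arr[OF R, of "e g"] that by (simp add: L_def Y_def)
  have L_in: "L g y \<in> pts Y" if "g \<in> carrier G" "y \<in> pts Y" for g y
    using L_arr that by (simp add: equivariant_maps_iff)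
  have L_mult: "L (g \<otimes>\<^bsub>G\<^esub> k) y = L g (L k y)"
    if "g \<in> carrier G" "k \<in> carrier G" "y \<in> pts Y" for g k y
    using \<Phi>_ract[OF R e_in[OF that(1)] that(2,3)] that by (simp add: ract_e L_def)
  have L_one: "L \<one>\<^bsub>G\<^esub> y = y" if "y \<in> pts Y" for y
  proof -
    have "(\<lambda>r\<in>pts R. r) \<in> equivariant_maps G R R"
      using fin_free_rsetD(4)[OF R] by (auto simp: equivariant_maps_iff)
    from equivariant_map_eq_orbit_map[OF R this] show ?thesis
      using is_functorD(2)[OF F R, of y] that by (simp add: L_def \<Phi>_def Y_def)
  qed
  have \<Phi>_decomp: "\<exists>k<n. \<exists>g\<in>carrier G. s = ract S (r k) g"
    if "is_coproduct (FinCat G) n (\<lambda>_. R) S (\<lambda>k. orbit_map S (r k))" and s: "s \<in> pts S"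
    for n S r s
  proof -
    have "s \<in> (\<lambda>(k, a). orbit_map S (r k) a) ` (SIGMA k:{..<n}. pts R)"
      using that by (simp add: is_coproduct_FinCat_iff[OF inf(1) G] bij_betw_def)
    then show ?thesis by (auto simp: pts_R; blast)
  qed
  have \<Phi>_bij: "bij_betw (\<lambda>(k, y). \<Phi> S (r k) y) (SIGMA k:{..<n}. pts Y) (pts (fobj F S))"
    if "is_coproduct (FinCat G) n (\<lambda>_. R) S (\<lambda>k. orbit_map S (r k))" for n :: nat and S r
  proof -
    have "is_coproduct (FinCat H) n (\<lambda>k. fobj F R) (fobj F S) (\<lambda>k. fmap F R S (orbit_map S (r k)))"
      using co that unfolding preserves_finite_coproducts_def by blast
    then show ?thesis
      unfolding is_coproduct_FinCat_iff[OF inf(2) H] by (simp add: \<Phi>_def Y_def)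
  qed
  have \<Phi>_eq_iff: "\<Phi> S s y = \<Phi> S s' y' \<longleftrightarrow> (\<exists>g\<in>carrier G. s = ract S s' g \<and> y' = L g y)"
    if S: "fin_free_rset G S" and s: "s \<in> pts S" and y: "y \<in> pts Y" and s': "s' \<in> pts S"
      and y': "y' \<in> pts Y" for S s y s' y'
  proof
    assume "\<exists>g\<in>carrier G. s = ract S s' g \<and> y' = L g y"
    then show "\<Phi> S s y = \<Phi> S s' y'" using \<Phi>_ract[OF S s' _ y] by auto
  next
    assume eq: "\<Phi> S s y = \<Phi> S s' y'"
    obtain n r where r: "\<And>k. k < n \<Longrightarrow> r k \<in> pts S"
      and cop: "is_coproduct (FinCat G) n (\<lambda>_. R) S (\<lambda>k. orbit_map S (r k))"
      using coproduct_of_orbits[OF inf(1) S] by blast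
    obtain k a where k: "k < n" and a: "a \<in> carrier G" "s = ract S (r k) a"
      using \<Phi>_decomp[OF cop s] by blast
    obtain l b where l: "l < n" and b: "b \<in> carrier G" "s' = ract S (r l) b"
      using \<Phi>_decomp[OF cop s'] by blast
    have "\<Phi> S (r k) (L a y) = \<Phi> S (r l) (L b y')"
      using eq \<Phi>_ract[OF S r] k l a b y y' by simp
    then have "(k, L a y) = (l, L b y')"
      using inj_onD[OF bij_betw_imp_inj_on[OF \<Phi>_bij[OF cop]], of "(k, L a y)" "(l, L b y')"]
        k l a b y y' by (simp add: L_in)
    then have kl: "k = l" "L a y = L b y'" by auto
    let ?g = "inv\<^bsub>G\<^esub> b \<otimes>\<^bsub>G\<^esub> a"
    have "ract S s' ?g = s"
      using a b kl(1) r[OF l] by (simp flip: fin_free_rsetD(6)[OF S] m_assoc)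
    moreover have "L ?g y = y'"
    proof -
      have "L ?g y = L (inv\<^bsub>G\<^esub> b) (L b y')" using a b y kl(2) by (simp add: L_mult)
      also have "\<dots> = y'" using b y' by (simp add: L_one flip: L_mult)
      finally show ?thesis .
    qed
    ultimately show "\<exists>g\<in>carrier G. s = ract S s' g \<and> y' = L g y"
      using a b by (intro bexI[of _ ?g]) auto
  qed
  have \<Phi>_surj: "\<exists>s y. s \<in> pts S \<and> y \<in> pts Y \<and> z = \<Phi> S s y"
    if S: "fin_free_rset G S" and z: "z \<in> pts (fobj F S)" for S z
  proof -
    obtain n r where r: "\<And>k. k < n \<Longrightarrow> r k \<in> pts S"
      and cop: "is_coproduct (FinCat G) n (\<lambda>_. R) S (\<lambda>k. orbit_map S (r k))"
      using coproduct_of_orbits[OF inf(1) S] by blast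
    have "z \<in> (\<lambda>(k, y). \<Phi> S (r k) y) ` (SIGMA k:{..<n}. pts Y)"
      using \<Phi>_bij[OF cop] z by (simp add: bij_betw_def)
    then show ?thesis using r by auto
  qed
  \<comment> \<open>It remains to rename the points of \<open>Y\<close> into the type \<open>'x\<close>.\<close>
  obtain X0 :: "('h, 'x) rset" and \<epsilon> where X0: "fin_free_rset H X0"
    and \<epsilon>: "bij_betw \<epsilon> (pts Y) (pts X0)"
    and ract_\<epsilon>: "\<And>y h. y \<in> pts Y \<Longrightarrow> h \<in> carrier H \<Longrightarrow> ract X0 (\<epsilon> y) h = \<epsilon> (ract Y y h)"
    using fin_free_rset_copy[OF inf(3) H Y(1-3)] by blast
  define \<delta> where "\<delta> = inv_into (pts Y) \<epsilon>"
  have \<delta>: "\<And>x. x \<in> pts X0 \<Longrightarrow> \<delta> x \<in> pts Y" "\<And>x. x \<in> pts X0 \<Longrightarrow> \<epsilon> (\<delta> x) = x"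
    "\<And>y. y \<in> pts Y \<Longrightarrow> \<delta> (\<epsilon> y) = y" "\<And>y. y \<in> pts Y \<Longrightarrow> \<epsilon> y \<in> pts X0"
    using \<epsilon> by (auto simp: \<delta>_def bij_betw_def f_inv_into_f inv_into_into)
  define X :: "('g, 'h, 'x) biset" where
    "X = \<lparr>pts = pts X0, ract = ract X0, lact = (\<lambda>g. \<lambda>x\<in>pts X0. \<epsilon> (L g (\<delta> x)))\<rparr>"
  have X: "pts X = pts X0" "ract X = ract X0"
    "\<And>g x. x \<in> pts X0 \<Longrightarrow> lact X g x = \<epsilon> (L g (\<delta> x))"
    "\<And>g. lact X g \<in> extensional (pts X0)"
    by (simp_all add: X_def)
  have \<delta>_ract: "\<delta> (ract X0 x h) = ract Y (\<delta> x) h" if "x \<in> pts X0" "h \<in> carrier H" for x h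
    using ract_\<epsilon>[of "\<delta> x" h] \<delta> that Y(4) by simp
  have \<delta>_eq_iff: "\<delta> x' = L g (\<delta> x) \<longleftrightarrow> x' = lact X g x"
    if "x \<in> pts X0" "x' \<in> pts X0" "g \<in> carrier G" for x x' g
    using that \<delta> L_in X(3) by metis
  have "group_action G (pts X) (lact X)"
    by (rule group_actionI[OF G]) (simp_all add: X \<delta> L_in L_one L_mult)
  moreover have "fin_free_rset H X"
    using X0 by (simp add: fin_free_rset_def right_action_def free_action_def X)
  moreover have "lact X g (ract X x h) = ract X (lact X g x) h"
    if "g \<in> carrier G" "x \<in> pts X" "h \<in> carrier H" for g x h
    using that L_arr[OF that(1)] fin_free_rsetD(4)[OF X0]
    by (simp add: X \<delta> \<delta>_ract L_in ract_\<epsilon> equivariant_maps_iff)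
  ultimately have biset: "fin_biset G H X" by (simp add: fin_biset_def)
  have "tensor_presentation G H F X (\<lambda>S s x. \<Phi> S s (\<delta> x))"
  proof (rule tensor_presentation.intro; (rule G H F biset)?)
    fix S :: "('g, 'a) rset" assume S: "fin_free_rset G S"
    show "pts (fobj F S) = {\<Phi> S s (\<delta> x) | s x. s \<in> pts S \<and> x \<in> pts X}"
    proof (intro equalityI subsetI)
      fix z assume "z \<in> pts (fobj F S)"
      then obtain s y where "s \<in> pts S" "y \<in> pts Y" "z = \<Phi> S s y" using \<Phi>_surj[OF S] by blast
      then have "z = \<Phi> S s (\<delta> (\<epsilon> y))" "s \<in> pts S" "\<epsilon> y \<in> pts X" using \<delta> X(1) by simp_all
      then show "z \<in> {\<Phi> S s (\<delta> x) | s x. s \<in> pts S \<and> x \<in> pts X}" by blast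
    qed (use \<Phi>_in[OF S] \<delta>(1) X(1) in auto)
    fix s x assume s: "s \<in> pts S" and x: "x \<in> pts X"
    show "\<Phi> S s (\<delta> x) = \<Phi> S s' (\<delta> x') \<longleftrightarrow> (\<exists>g\<in>carrier G. s = ract S s' g \<and> x' = lact X g x)"
      if "s' \<in> pts S" "x' \<in> pts X" for s' x'
      using s x that \<delta> \<delta>_eq_iff by (simp add: \<Phi>_eq_iff[OF S] X(1,2) cong: bex_cong)
    show "ract (fobj F S) (\<Phi> S s (\<delta> x)) h = \<Phi> S s (\<delta> (ract X x h))" if "h \<in> carrier H" for h
      using x that \<Phi>_arr[OF S s] \<delta> by (simp add: X(1,2) \<delta>_ract equivariant_maps_iff)
    show "fmap F S T f (\<Phi> S s (\<delta> x)) = \<Phi> T (f s) (\<delta> x)"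
      if "fin_free_rset G T" "f \<in> equivariant_maps G S T" for T f
      using fmap_\<Phi>[OF S that s] x \<delta> by (simp add: X(1))
  qed
  then show ?thesis by (rule that)
qed

end

section \<open>The characterisation\<close>

theorem theorem4p0p0p3:
  fixes G :: "('g, 'm) monoid_scheme" and H :: "('h, 'n) monoid_scheme"
    and F :: "(('g, 'a) rset, 'a \<Rightarrow> 'a, ('h, 'b) rset, 'b \<Rightarrow> 'b) funct"
  assumes "infinite (UNIV :: 'a set)" "infinite (UNIV :: 'b set)" "infinite (UNIV :: 'x set)"
    and "group G" "finite (carrier G)" "group H" "finite (carrier H)"
    and "is_functor (FinCat G) (FinCat H) F"
  shows "(preserves_pullbacks (FinCat G) (FinCat H) F \<and>
          preserves_epis (FinCat G) (FinCat H) F \<and>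
          preserves_finite_coproducts (FinCat G) (FinCat H) F) \<longleftrightarrow>
         (\<exists>X :: ('g, 'h, 'x) biset. fin_biset G H X \<and>
            naturally_isomorphic G H F (tensor_functor G H X))"
proof
  assume "preserves_pullbacks (FinCat G) (FinCat H) F \<and>
    preserves_epis (FinCat G) (FinCat H) F \<and>
    preserves_finite_coproducts (FinCat G) (FinCat H) F"
  then have co: "preserves_finite_coproducts (FinCat G) (FinCat H) F" by blast
  obtain R :: "('g, 'a) rset" and e where "regular_rset G R e"
    by (rule regular_rset_exists[OF assms(1,4,5)])
  then interpret regular_rset G R e .
  obtain X :: "('g, 'h, 'x) biset" and P where "tensor_presentation G H F X P"
    by (rule tensor_presentation_of_coproducts[OF assms(1,2,3,6,8) co])
  then interpret tensor_presentation G H F X P .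
  show "\<exists>X :: ('g, 'h, 'x) biset. fin_biset G H X \<and>
    naturally_isomorphic G H F (tensor_functor G H X)"
    using X naturally_isomorphic_tensor_functor by blast
next
  assume "\<exists>X :: ('g, 'h, 'x) biset. fin_biset G H X \<and>
    naturally_isomorphic G H F (tensor_functor G H X)"
  then obtain X :: "('g, 'h, 'x) biset" where X: "fin_biset G H X"
    and iso: "naturally_isomorphic G H F (tensor_functor G H X)" by blast
  obtain P where "tensor_presentation G H F X P"
    by (rule tensor_presentation_exists[OF assms(4,6,8) X iso])
  then interpret tensor_presentation G H F X P .
  show "preserves_pullbacks (FinCat G) (FinCat H) F \<and>
    preserves_epis (FinCat G) (FinCat H) F \<and>
    preserves_finite_coproducts (FinCat G) (FinCat H) F"
    using preserves_pullbacks_of_presentation[OF assms(1,2,5,7)]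
      preserves_epis_of_presentation[OF assms(1,2)]
      preserves_finite_coproducts_of_presentation[OF assms(1,2)] by blast
qed

end
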